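(* Let $R$ be an integral domain and let $(K,w)$ be a weighted simplicial complex with $K$ finite and $w:K\to R$, equipped with a discrete Morse function $f:K\to\mathbb{R}$. Let $a<b$ be real numbers. Suppose that for all simplices $\alpha\in K$, $f(\alpha)\in(a,b]$ implies that $\alpha$ is non-critical and $w$-simple. Then $K(b)\searrow K(a)$, and this is a collapse that preserves weighted homology, i.e. $H_i(K(b),w)\cong H_i(K(a),w)$ for all $i\ge 0$.
   Context: $R$ is an integral domain (commutative, with unity). Simplicial complexes are finite abstract simplicial complexes (simplices are nonempty finite sets of vertices); $\sigma^{(n)}$ indicates that $\dim\sigma=n$, and $\sigma<\tau$ means $\sigma\subsetneq\tau$. A weighted simplicial complex (WSC) is a pair $(K,w)$ of a simplicial complex $K$ and a function $w:K\to R$ such that $\sigma_1\subseteq\sigma_2$ implies $w(\sigma_1)\mid w(\sigma_2)$ in $R$. $C_n(K,w)$ is the free $R$-module with basis the $n$-simplices of $K$ with nonzero weight ($C_{-1}=0$). Fixing a total order on the vertices, the weighted boundary map $\partial_n^w:C_n(K,w)\to C_{n-1}(K,w)$ is the $R$-linear map with $\partial_n^w(\sigma)=\sum_{i=0}^n\frac{w(\sigma)}{w(d_i\sigma)}(-1)^i d_i\sigma$, where $d_i[v_0,\dots,v_n]=[v_0,\dots,\widehat{v_i},\dots,v_n]$. The weighted homology is the $R$-module $H_n(K,w)=\ker(\partial_n^w)/\operatorname{Im}(\partial_{n+1}^w)$. For a subcomplex $L\subseteq K$, $(L,w)$ means $(L,w|_L)$. If $\sigma<\tau$ and $\sigma$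 is not a proper face of any simplex of $K$ other than $\tau$, then $\sigma$ is a free face of $\tau$ (in $K$), and $K$ is said to collapse onto $K\setminus\{\sigma,\tau\}$ by an elementary collapse. $K\searrow L$ ($K$ collapses onto $L$) means that $K$ can be transformed into $L$ by a finite (possibly empty) sequence of elementary collapses. A function $f:K\to\mathbb{R}$ is a discrete Morse function if for every $\alpha^{(n)}\in K$: (1) $|\{\beta^{(n+1)}>\alpha\mid f(\beta)\le f(\alpha)\}|\le 1$ and (2) $|\{\gamma^{(n-1)}<\alpha\mid f(\gamma)\ge f(\alpha)\}|\le 1$. A simplex $\alpha^{(n)}$ is critical if both of these sets are empty. A simplex $\alpha^{(n)}$ is $w$-simple if $w(\alpha)\ne0$ and for all $\gamma^{(n-1)}<\alpha$, $f(\gamma)\ge f(\alpha)$ implies $w(\gamma)=w(\alpha)$. For $c\in\mathbb{R}$, the level subcomplex $K(c)$ is the subcomplex of $K$ consisting of all simplices $\alpha\in K$ with $f(\alpha)\le c$ together with all of their faces. *)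

theory Defs
  imports Complex_Main "HOL-Algebra.AbelCoset" "HOL-Algebra.Module"
begin

section \<open>Modules\<close>

text \<open>
  The product and unit fields of module records play no role. The scalar action on cosets is
  the usual one, \<open>r (x + N) = r x + N\<close>; the union ranges over equal cosets and thus avoids
  choosing a representative.
\<close>

definition quotient_module ::
    "('r, 'm) module \<Rightarrow> 'm set \<Rightarrow> ('r, 'm set) module" where
  "quotient_module M N =
     \<lparr>carrier = a_rcosets\<^bsub>M\<^esub> N, mult = undefined, one = undefined, zero = N,
      add = (\<lambda>X Y. X <+>\<^bsub>M\<^esub> Y), smult = (\<lambda>r X. \<Union>x\<in>X. N +>\<^bsub>M\<^esub> (r \<odot>\<^bsub>M\<^esub> x))\<rparr>"

text \<open>The ring of scalars is the whole type \<open>'r\<close>.\<close>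

definition module_isomorphic ::
    "('r, 'm) module \<Rightarrow> ('r, 'n) module \<Rightarrow> bool" where
  "module_isomorphic M N \<longleftrightarrow>
     (\<exists>\<phi> \<in> iso (add_monoid M) (add_monoid N).
        \<forall>r. \<forall>x \<in> carrier M. \<phi> (r \<odot>\<^bsub>M\<^esub> x) = r \<odot>\<^bsub>N\<^esub> \<phi> x)"

section \<open>Weighted simplicial complexes\<close>

definition simplicial_complex :: "'v set set \<Rightarrow> bool" where
  "simplicial_complex K \<longleftrightarrow> finite K \<and>
     (\<forall>\<sigma>\<in>K. finite \<sigma> \<and> \<sigma> \<noteq> {} \<and> (\<forall>\<tau>. \<tau> \<noteq> {} \<and> \<tau> \<subseteq> \<sigma> \<longrightarrow> \<tau> \<in> K))"

definition simplex_dim :: "'v set \<Rightarrow> nat" where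
  "simplex_dim \<sigma> = card \<sigma> - 1"

definition weighted_simplicial_complex ::
    "'v set set \<Rightarrow> ('v set \<Rightarrow> 'r::idom) \<Rightarrow> bool" where
  "weighted_simplicial_complex K w \<longleftrightarrow> simplicial_complex K \<and>
     (\<forall>\<sigma>\<^sub>1\<in>K. \<forall>\<sigma>\<^sub>2\<in>K. \<sigma>\<^sub>1 \<subseteq> \<sigma>\<^sub>2 \<longrightarrow> w \<sigma>\<^sub>1 dvd w \<sigma>\<^sub>2)"

section \<open>Weighted homology\<close>

text \<open>The quotient \<open>a / b\<close> in an integral domain, for \<open>b \<noteq> 0\<close> dividing \<open>a\<close>; arbitrary otherwise.\<close>

definition exact_quotient :: "'r::idom \<Rightarrow> 'r \<Rightarrow> 'r" where
  "exact_quotient a b = (THE q. a = q * b)"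

definition chain_basis :: "'v set set \<Rightarrow> ('v set \<Rightarrow> 'r::idom) \<Rightarrow> nat \<Rightarrow> 'v set set" where
  "chain_basis K w n = {\<sigma>\<in>K. simplex_dim \<sigma> = n \<and> w \<sigma> \<noteq> 0}"

text \<open>A chain is represented by its coefficient function.\<close>

definition chain_module ::
    "'v set set \<Rightarrow> ('v set \<Rightarrow> 'r::idom) \<Rightarrow> nat \<Rightarrow> ('r, 'v set \<Rightarrow> 'r) module" where
  "chain_module K w n =
     \<lparr>carrier = {c. \<forall>\<sigma>. c \<sigma> \<noteq> 0 \<longrightarrow> \<sigma> \<in> chain_basis K w n},
      mult = undefined, one = undefined, zero = (\<lambda>_. 0),
      add = (\<lambda>c d \<sigma>. c \<sigma> + d \<sigma>), smult = (\<lambda>r c \<sigma>. r * c \<sigma>)\<rparr>"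

text \<open>The total order on the vertices is the one of the type \<open>'v\<close>.\<close>

definition simplex_face :: "nat \<Rightarrow> 'v::linorder set \<Rightarrow> 'v set" where
  "simplex_face i \<sigma> = \<sigma> - {sorted_list_of_set \<sigma> ! i}"

definition simplex_boundary ::
    "('v::linorder set \<Rightarrow> 'r::idom) \<Rightarrow> 'v set \<Rightarrow> 'v set \<Rightarrow> 'r" where
  "simplex_boundary w \<sigma> = (\<lambda>\<rho>. \<Sum>i = 0..simplex_dim \<sigma>.
     if \<rho> = simplex_face i \<sigma>
     then exact_quotient (w \<sigma>) (w (simplex_face i \<sigma>)) * (- 1) ^ i else 0)"

text \<open>\<open>weighted_boundary K w n\<close> maps \<open>n\<close>-chains to \<open>(n - 1)\<close>-chains; for \<open>n = 0\<close> it is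
  the zero map, as the module of \<open>(- 1)\<close>-chains is trivial.\<close>

definition weighted_boundary ::
    "'v::linorder set set \<Rightarrow> ('v set \<Rightarrow> 'r::idom) \<Rightarrow> nat \<Rightarrow> ('v set \<Rightarrow> 'r) \<Rightarrow> 'v set \<Rightarrow> 'r" where
  "weighted_boundary K w n c = (\<lambda>\<rho>.
     if n = 0 then 0 else \<Sum>\<sigma>\<in>chain_basis K w n. c \<sigma> * simplex_boundary w \<sigma> \<rho>)"

definition cycles ::
    "'v::linorder set set \<Rightarrow> ('v set \<Rightarrow> 'r::idom) \<Rightarrow> nat \<Rightarrow> ('v set \<Rightarrow> 'r) set" where
  "cycles K w n = {c \<in> carrier (chain_module K w n). weighted_boundary K w n c = (\<lambda>_. 0)}"

definition boundaries ::
    "'v::linorder set set \<Rightarrow> ('v set \<Rightarrow> 'r::idom) \<Rightarrow> nat \<Rightarrow> ('v set \<Rightarrow> 'r) set" where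
  "boundaries K w n = weighted_boundary K w (n + 1) ` carrier (chain_module K w (n + 1))"

definition weighted_homology ::
    "'v::linorder set set \<Rightarrow> ('v set \<Rightarrow> 'r::idom) \<Rightarrow> nat \<Rightarrow> ('r, ('v set \<Rightarrow> 'r) set) module" where
  "weighted_homology K w n =
     quotient_module ((chain_module K w n)\<lparr>carrier := cycles K w n\<rparr>) (boundaries K w n)"

section \<open>Collapses\<close>

definition free_face :: "'v set set \<Rightarrow> 'v set \<Rightarrow> 'v set \<Rightarrow> bool" where
  "free_face K \<sigma> \<tau> \<longleftrightarrow> \<sigma> \<in> K \<and> \<tau> \<in> K \<and> \<sigma> \<subset> \<tau> \<and> (\<forall>\<rho>\<in>K. \<sigma> \<subset> \<rho> \<longrightarrow> \<rho> = \<tau>)"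

definition elementary_collapse :: "'v set set \<Rightarrow> 'v set set \<Rightarrow> bool" where
  "elementary_collapse K L \<longleftrightarrow> (\<exists>\<sigma> \<tau>. free_face K \<sigma> \<tau> \<and> L = K - {\<sigma>, \<tau>})"

definition collapses_onto :: "'v set set \<Rightarrow> 'v set set \<Rightarrow> bool" where
  "collapses_onto = elementary_collapse\<^sup>*\<^sup>*"

section \<open>Discrete Morse functions\<close>

definition upper_exceptions ::
    "'v set set \<Rightarrow> ('v set \<Rightarrow> real) \<Rightarrow> 'v set \<Rightarrow> 'v set set" where
  "upper_exceptions K f \<alpha> =
     {\<beta>\<in>K. simplex_dim \<beta> = simplex_dim \<alpha> + 1 \<and> \<alpha> \<subset> \<beta> \<and> f \<beta> \<le> f \<alpha>}"

definition lower_exceptions ::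
    "'v set set \<Rightarrow> ('v set \<Rightarrow> real) \<Rightarrow> 'v set \<Rightarrow> 'v set set" where
  "lower_exceptions K f \<alpha> =
     {\<gamma>\<in>K. simplex_dim \<alpha> = simplex_dim \<gamma> + 1 \<and> \<gamma> \<subset> \<alpha> \<and> f \<gamma> \<ge> f \<alpha>}"

definition discrete_morse_function :: "'v set set \<Rightarrow> ('v set \<Rightarrow> real) \<Rightarrow> bool" where
  "discrete_morse_function K f \<longleftrightarrow>
     (\<forall>\<alpha>\<in>K. card (upper_exceptions K f \<alpha>) \<le> 1 \<and> card (lower_exceptions K f \<alpha>) \<le> 1)"

definition critical :: "'v set set \<Rightarrow> ('v set \<Rightarrow> real) \<Rightarrow> 'v set \<Rightarrow> bool" where
  "critical K f \<alpha> \<longleftrightarrow> upper_exceptions K f \<alpha> = {} \<and> lower_exceptions K f \<alpha> = {}"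

definition w_simple ::
    "'v set set \<Rightarrow> ('v set \<Rightarrow> 'r::idom) \<Rightarrow> ('v set \<Rightarrow> real) \<Rightarrow> 'v set \<Rightarrow> bool" where
  "w_simple K w f \<alpha> \<longleftrightarrow> w \<alpha> \<noteq> 0 \<and>
     (\<forall>\<gamma>\<in>K. simplex_dim \<alpha> = simplex_dim \<gamma> + 1 \<and> \<gamma> \<subset> \<alpha> \<and> f \<gamma> \<ge> f \<alpha> \<longrightarrow> w \<gamma> = w \<alpha>)"

definition level_subcomplex ::
    "'v set set \<Rightarrow> ('v set \<Rightarrow> real) \<Rightarrow> real \<Rightarrow> 'v set set" where
  "level_subcomplex K f c = {\<sigma>\<in>K. \<exists>\<alpha>\<in>K. \<sigma> \<subseteq> \<alpha> \<and> f \<alpha> \<le> c}"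

end

theory Submission
  imports Defs
begin

text \<open>
  The simplices of \<open>K(b) - K(a)\<close> are perfectly matched into pairs \<open>\<sigma> < \<tau>\<close> of consecutive
  dimensions with \<open>f \<tau> \<le> f \<sigma>\<close>, and then \<open>f \<tau>\<close> lies in \<open>(a, b]\<close>, so that
  \<open>w \<sigma> = w \<tau> \<noteq> 0\<close>. A pair with \<open>f \<tau>\<close> maximal is a free pair and can be collapsed. Since
  \<open>\<sigma>\<close> occurs in the boundary of \<open>\<tau>\<close> with coefficient \<open>\<plusminus>1\<close>, each cycle can be moved off
  \<open>{\<sigma>, \<tau>}\<close> by a boundary, and a boundary that avoids \<open>{\<sigma>, \<tau>}\<close> bounds a chain that does too.
\<close>

section \<open>Quotients of function modules\<close>

text \<open>A face may have a larger value than a simplex above it, so some simplices lie in a level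
  subcomplex only as faces of others. The hypotheses speak of values in (a, b] alone, and the
  simplices of larger value must still be matched: descending through facets turns a coface of small
  value into a partner one dimension up.

  Besides the two uniqueness conditions on \<open>f\<close>, the combinatorics rests on one
  configuration: between two simplices that differ by two vertices there is a second intermediate
  simplex, whose value is squeezed into a contradiction. This rules out chained pairs and yields
  freeness.

  In the algebra, each collapse is recorded by relations between sets of cycles and boundaries,
  which compose directly; an isomorphism is built only once, at the end.\<close>

definition fun_submodule :: "('a \<Rightarrow> 'r::comm_ring_1) set \<Rightarrow> bool" where
  "fun_submodule S \<longleftrightarrow> (\<lambda>_. 0) \<in> S \<and> (\<forall>x\<in>S. \<forall>y\<in>S. (\<lambda>s. x s + y s) \<in> S) \<and>
     (\<forall>r. \<forall>x\<in>S. (\<lambda>s. r * x s) \<in> S)"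

lemma fun_submodule_add:
  "fun_submodule S \<Longrightarrow> x \<in> S \<Longrightarrow> y \<in> S \<Longrightarrow> (\<lambda>s. x s + y s) \<in> S"
  by (simp add: fun_submodule_def)

lemma fun_submodule_smult:
  "fun_submodule S \<Longrightarrow> x \<in> S \<Longrightarrow> (\<lambda>s. r * x s) \<in> S"
  by (simp add: fun_submodule_def)

lemma fun_submodule_diff:
  assumes "fun_submodule S" "x \<in> S" "y \<in> S"
  shows "(\<lambda>s. x s - y s) \<in> S"
  using fun_submodule_add[OF assms(1,2) fun_submodule_smult[OF assms(1,3), of "- 1"]] by simp

text \<open>No carrier appears: a coset in \<open>fun_module Z\<close> depends on addition alone, so
  one formula serves both quotients.\<close>

definition fun_coset :: "('a \<Rightarrow> 'r::comm_ring_1) set \<Rightarrow> ('a \<Rightarrow> 'r) \<Rightarrow> ('a \<Rightarrow> 'r) set" where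
  "fun_coset B z = {y. (\<lambda>s. y s - z s) \<in> B}"

lemma fun_coset_self: "fun_submodule B \<Longrightarrow> z \<in> fun_coset B z"
  by (simp add: fun_coset_def fun_submodule_def)

lemma fun_coset_eqI:
  assumes B: "fun_submodule B" and "(\<lambda>s. x s - y s) \<in> B"
  shows "fun_coset B x = fun_coset B y"
proof -
  have "(\<lambda>s. z s - x s) \<in> B \<longleftrightarrow> (\<lambda>s. z s - y s) \<in> B" for z
  proof
    assume "(\<lambda>s. z s - x s) \<in> B"
    from fun_submodule_add[OF B this assms(2)] show "(\<lambda>s. z s - y s) \<in> B" by simp
  next
    assume "(\<lambda>s. z s - y s) \<in> B"
    from fun_submodule_diff[OF B this assms(2)] show "(\<lambda>s. z s - x s) \<in> B" by simp
  qed
  thus ?thesis by (simp add: fun_coset_def)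
qed

lemma fun_coset_eqD:
  "fun_submodule B \<Longrightarrow> fun_coset B x = fun_coset B y \<Longrightarrow> (\<lambda>s. x s - y s) \<in> B"
  using fun_coset_self[of B x] by (auto simp: fun_coset_def)

text \<open>The record of \<open>chain_module\<close> with a free carrier, into which the cycles of
  either complex can be put.\<close>

definition fun_module :: "('a \<Rightarrow> 'r::comm_ring_1) set \<Rightarrow> ('r, 'a \<Rightarrow> 'r) module" where
  "fun_module Z = \<lparr>carrier = Z, mult = undefined, one = undefined, zero = (\<lambda>_. 0),
      add = (\<lambda>c d \<sigma>. c \<sigma> + d \<sigma>), smult = (\<lambda>r c \<sigma>. r * c \<sigma>)\<rparr>"

lemma fun_module_a_r_coset: "B +>\<^bsub>fun_module Z\<^esub> z = fun_coset B z"
proof -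
  have "y \<in> B +>\<^bsub>fun_module Z\<^esub> z \<longleftrightarrow> (\<exists>b\<in>B. y = (\<lambda>s. b s + z s))" for y
    by (auto simp: a_r_coset_def' fun_module_def)
  moreover have "(\<exists>b\<in>B. y = (\<lambda>s. b s + z s)) \<longleftrightarrow> (\<lambda>s. y s - z s) \<in> B" for y
  proof
    assume "(\<lambda>s. y s - z s) \<in> B"
    thus "\<exists>b\<in>B. y = (\<lambda>s. b s + z s)" by (rule rev_bexI) auto
  qed auto
  ultimately show ?thesis by (auto simp: fun_coset_def)
qed

lemma fun_module_a_rcosets: "a_rcosets\<^bsub>fun_module Z\<^esub> B = fun_coset B ` Z"
proof -
  have "carrier (fun_module Z) = Z" by (simp add: fun_module_def)
  thus ?thesis by (auto simp: A_RCOSETS_def' fun_module_a_r_coset)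
qed

lemma fun_module_set_add:
  assumes B: "fun_submodule B"
  shows "fun_coset B x <+>\<^bsub>fun_module Z\<^esub> fun_coset B y = fun_coset B (\<lambda>s. x s + y s)"
proof (intro equalityI subsetI)
  fix u assume "u \<in> fun_coset B x <+>\<^bsub>fun_module Z\<^esub> fun_coset B y"
  then obtain p q where pq: "(\<lambda>s. p s - x s) \<in> B" "(\<lambda>s. q s - y s) \<in> B" "u = (\<lambda>s. p s + q s)"
    by (auto simp: set_add_def' fun_module_def fun_coset_def)
  show "u \<in> fun_coset B (\<lambda>s. x s + y s)"
    using fun_submodule_add[OF B pq(1,2)] pq(3) by (simp add: fun_coset_def algebra_simps)
next
  fix u assume "u \<in> fun_coset B (\<lambda>s. x s + y s)"
  hence "(\<lambda>s. u s - y s) \<in> fun_coset B x" by (simp add: fun_coset_def algebra_simps)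
  moreover have "u = (\<lambda>s. (u s - y s) + y s)" by simp
  ultimately show "u \<in> fun_coset B x <+>\<^bsub>fun_module Z\<^esub> fun_coset B y"
    using fun_coset_self[OF B, of y] unfolding set_add_def' fun_module_def by fastforce
qed

lemma fun_module_smult_coset:
  assumes B: "fun_submodule B"
  shows "(\<Union>u\<in>fun_coset B x. B +>\<^bsub>fun_module Z\<^esub> (r \<odot>\<^bsub>fun_module Z\<^esub> u)) =
    fun_coset B (\<lambda>s. r * x s)"
proof -
  have "fun_coset B (\<lambda>s. r * u s) = fun_coset B (\<lambda>s. r * x s)" if "u \<in> fun_coset B x" for u
  proof (rule fun_coset_eqI[OF B])
    have "(\<lambda>s. u s - x s) \<in> B" using that by (simp add: fun_coset_def)
    from fun_submodule_smult[OF B this, of r]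
    show "(\<lambda>s. r * u s - r * x s) \<in> B" by (simp add: algebra_simps)
  qed
  hence "(\<Union>u\<in>fun_coset B x. fun_coset B (\<lambda>s. r * u s)) = (\<Union>u\<in>fun_coset B x. fun_coset B (\<lambda>s. r * x s))"
    by (rule SUP_cong[OF refl])
  \<comment> \<open>The family is constant, and its index set is nonempty because it contains
    \<open>x\<close>.\<close>
  also have "\<dots> = fun_coset B (\<lambda>s. r * x s)" using fun_coset_self[OF B, of x] by blast
  finally show ?thesis by (simp add: fun_module_a_r_coset) (simp add: fun_module_def)
qed

text \<open>The isomorphism sends a coset to its intersection with \<open>Z'\<close>.\<close>

lemma quotient_module_isomorphic:
  fixes Z Z' B B' :: "('a \<Rightarrow> 'r::comm_ring_1) set"
  assumes Z': "fun_submodule Z'" and B: "fun_submodule B"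
    and B': "B' = B \<inter> Z'" and sub: "Z' \<subseteq> Z"
    and sum: "\<And>z. z \<in> Z \<Longrightarrow> \<exists>z'\<in>Z'. (\<lambda>s. z s - z' s) \<in> B"
  shows "module_isomorphic (quotient_module (fun_module Z) B) (quotient_module (fun_module Z') B')"
proof -
  have smB': "fun_submodule B'"
    using Z' B unfolding B' fun_submodule_def by simp
  let ?Q = "quotient_module (fun_module Z) B" and ?Q' = "quotient_module (fun_module Z') B'"
  let ?\<phi> = "\<lambda>X. X \<inter> Z'"
  have carr: "carrier ?Q = fun_coset B ` Z" "carrier ?Q' = fun_coset B' ` Z'"
    by (simp_all add: quotient_module_def fun_module_a_rcosets)
  \<comment> \<open>The map inverts the one induced by the inclusion of \<open>Z'\<close> in
    \<open>Z\<close>. With representatives in \<open>Z'\<close> available for every coset, each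
    property can be checked on them.\<close>
  have rep: "\<exists>z'\<in>Z'. X = fun_coset B z'" if "X \<in> carrier ?Q" for X
    using that sum fun_coset_eqI[OF B] unfolding carr by fastforce
  have phi: "?\<phi> (fun_coset B z) = fun_coset B' z" if "z \<in> Z'" for z
  proof -
    \<comment> \<open>Translation by an element of \<open>Z'\<close> preserves \<open>Z'\<close>, so
      the intersection is exactly a coset of \<open>B'\<close>.\<close>
    have "y \<in> Z' \<longleftrightarrow> (\<lambda>s. y s - z s) \<in> Z'" for y
    proof
      assume "(\<lambda>s. y s - z s) \<in> Z'"
      from fun_submodule_add[OF Z' this that] show "y \<in> Z'" by simp
    qed (rule fun_submodule_diff[OF Z' _ that])
    thus ?thesis by (auto simp: fun_coset_def B')
  qed
  note addZ = fun_submodule_add[OF Z'] and smZ = fun_submodule_smult[OF Z']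
  have add: "fun_coset B x \<oplus>\<^bsub>?Q\<^esub> fun_coset B y = fun_coset B (\<lambda>s. x s + y s)" for x y
    using fun_module_set_add[OF B] by (simp add: quotient_module_def)
  have add': "fun_coset B' x \<oplus>\<^bsub>?Q'\<^esub> fun_coset B' y = fun_coset B' (\<lambda>s. x s + y s)" for x y
    using fun_module_set_add[OF smB'] by (simp add: quotient_module_def)
  have smult: "r \<odot>\<^bsub>?Q\<^esub> fun_coset B x = fun_coset B (\<lambda>s. r * x s)" for r x
    using fun_module_smult_coset[OF B] by (simp add: quotient_module_def)
  have smult': "r \<odot>\<^bsub>?Q'\<^esub> fun_coset B' x = fun_coset B' (\<lambda>s. r * x s)" for r x
    using fun_module_smult_coset[OF smB'] by (simp add: quotient_module_def)
  have hom: "?\<phi> \<in> hom (add_monoid ?Q) (add_monoid ?Q')"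
  proof (rule homI)
    fix X assume "X \<in> carrier (add_monoid ?Q)"
    then obtain x where "x \<in> Z'" "X = fun_coset B x" using rep by auto
    thus "?\<phi> X \<in> carrier (add_monoid ?Q')" by (simp add: phi carr)
  next
    fix X Y assume "X \<in> carrier (add_monoid ?Q)" "Y \<in> carrier (add_monoid ?Q)"
    then obtain x y where "x \<in> Z'" "X = fun_coset B x" "y \<in> Z'" "Y = fun_coset B y"
      using rep by (metis partial_object.select_convs(1))
    thus "?\<phi> (X \<otimes>\<^bsub>add_monoid ?Q\<^esub> Y) = ?\<phi> X \<otimes>\<^bsub>add_monoid ?Q'\<^esub> ?\<phi> Y"
      by (simp add: phi add add' addZ)
  qed
  have inj: "inj_on ?\<phi> (carrier ?Q)"
  proof (rule inj_onI)
    fix X Y assume "X \<in> carrier ?Q" "Y \<in> carrier ?Q" and eq: "?\<phi> X = ?\<phi> Y"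
    then obtain x y where xy: "x \<in> Z'" "X = fun_coset B x" "y \<in> Z'" "Y = fun_coset B y"
      using rep by metis
    hence "fun_coset B' x = fun_coset B' y" using eq by (simp add: phi)
    hence "(\<lambda>s. x s - y s) \<in> B" using fun_coset_eqD[OF smB'] B' by blast
    thus "X = Y" using fun_coset_eqI[OF B] xy by simp
  qed
  have surj: "?\<phi> ` carrier ?Q = carrier ?Q'"
  proof (intro equalityI subsetI)
    fix Y assume "Y \<in> ?\<phi> ` carrier ?Q"
    then obtain X where X: "X \<in> carrier ?Q" "Y = ?\<phi> X" by (rule imageE)
    obtain x where "x \<in> Z'" "X = fun_coset B x" using rep[OF X(1)] by blast
    with X(2) have "x \<in> Z'" "Y = ?\<phi> (fun_coset B x)" by simp_all
    thus "Y \<in> carrier ?Q'" by (simp add: phi carr)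
  next
    fix Y assume "Y \<in> carrier ?Q'"
    then obtain x where x: "x \<in> Z'" "Y = fun_coset B' x" by (auto simp: carr)
    show "Y \<in> ?\<phi> ` carrier ?Q"
    proof (rule image_eqI)
      show "Y = ?\<phi> (fun_coset B x)" using phi[OF x(1)] x(2) by simp
      show "fun_coset B x \<in> carrier ?Q" using x(1) sub by (auto simp: carr)
    qed
  qed
  have "?\<phi> \<in> iso (add_monoid ?Q) (add_monoid ?Q')"
    using hom inj surj by (simp add: iso_def bij_betw_def)
  moreover have "?\<phi> (r \<odot>\<^bsub>?Q\<^esub> X) = r \<odot>\<^bsub>?Q'\<^esub> ?\<phi> X" if X: "X \<in> carrier ?Q" for r X
  proof -
    obtain x where "x \<in> Z'" "X = fun_coset B x" using rep[OF X] by blast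
    thus ?thesis by (simp add: phi smult smult' smZ)
  qed
  ultimately show ?thesis
    unfolding module_isomorphic_def by (intro bexI[of _ ?\<phi>] allI ballI)
qed

section \<open>The weighted chain complex\<close>

lemma exact_quotient_mult:
  fixes a b :: "'r::idom"
  assumes "b dvd a" "b \<noteq> 0"
  shows "exact_quotient a b * b = a"
proof -
  obtain q where q: "a = q * b" using assms(1) by (metis dvdE mult.commute)
  have "exact_quotient a b = q"
    unfolding exact_quotient_def using q assms(2) by (intro the_equality) auto
  thus ?thesis using q by simp
qed

lemma exact_quotient_self: "b \<noteq> 0 \<Longrightarrow> exact_quotient b b = (1::'r::idom)"
  using exact_quotient_mult[of b b] by simp

lemma simplicial_complex_finite_simplex: "simplicial_complex K \<Longrightarrow> \<sigma> \<in> K \<Longrightarrow> finite \<sigma>"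
  by (simp add: simplicial_complex_def)

lemma simplicial_complex_face:
  "simplicial_complex K \<Longrightarrow> \<beta> \<in> K \<Longrightarrow> \<alpha> \<subseteq> \<beta> \<Longrightarrow> \<alpha> \<noteq> {} \<Longrightarrow> \<alpha> \<in> K"
  unfolding simplicial_complex_def by blast

lemma simplex_card_pos: "simplicial_complex K \<Longrightarrow> \<sigma> \<in> K \<Longrightarrow> 0 < card \<sigma>"
  unfolding simplicial_complex_def card_gt_0_iff by blast

text \<open>Since \<open>simplex_dim\<close> uses truncated subtraction, the passage to
  cardinalities rests on simplices being nonempty.\<close>

lemma simplex_dim_Suc_iff:
  assumes "simplicial_complex K" "\<sigma> \<in> K" "\<tau> \<in> K"
  shows "simplex_dim \<tau> = simplex_dim \<sigma> + 1 \<longleftrightarrow> card \<tau> = Suc (card \<sigma>)"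
  using simplex_card_pos[OF assms(1,2)] simplex_card_pos[OF assms(1,3)]
  unfolding simplex_dim_def by linarith

text \<open>Trades a list index for a count of smaller vertices, which is easy to follow when a
  vertex is deleted; the signs in the boundary are handled in this form.\<close>

lemma card_sorted_list_nth:
  fixes \<sigma> :: "'v::linorder set"
  assumes "finite \<sigma>" "i < card \<sigma>"
  shows "card {v\<in>\<sigma>. v < sorted_list_of_set \<sigma> ! i} = i"
proof -
  let ?xs = "sorted_list_of_set \<sigma>"
  have len: "length ?xs = card \<sigma>" by simp
  have s: "sorted_wrt (<) ?xs" by (rule strict_sorted_list_of_set)
  have "{v\<in>\<sigma>. v < ?xs ! i} = (\<lambda>j. ?xs ! j) ` {..<i}"
  proof (intro equalityI subsetI)
    fix v assume v: "v \<in> {v\<in>\<sigma>. v < ?xs ! i}"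
    hence "v \<in> set ?xs" using assms by simp
    then obtain j where j: "j < card \<sigma>" "v = ?xs ! j" using len by (metis in_set_conv_nth)
    have "j < i"
    proof (rule ccontr)
      assume "\<not> j < i"
      hence "?xs ! i \<le> ?xs ! j" using j len by (intro sorted_nth_mono) simp_all
      thus False using v j by auto
    qed
    thus "v \<in> (\<lambda>j. ?xs ! j) ` {..<i}" using j by auto
  next
    fix v assume "v \<in> (\<lambda>j. ?xs ! j) ` {..<i}"
    then obtain j where j: "j < i" "v = ?xs ! j" by auto
    have "?xs ! j < ?xs ! i" using sorted_wrt_nth_less[OF s j(1)] assms(2) len by simp
    moreover have "v \<in> set ?xs" unfolding j(2) using j(1) assms(2) len by (intro nth_mem) simp
    hence "v \<in> \<sigma>" using assms(1) by simp
    ultimately show "v \<in> {v\<in>\<sigma>. v < ?xs ! i}" using j by simp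
  qed
  moreover have "inj_on (\<lambda>j. ?xs ! j) {..<i}"
    using assms len by (intro inj_on_nth) auto
  ultimately show ?thesis by (simp add: card_image)
qed

text \<open>Deleting different vertices gives different facets, so a single summand of the boundary
  survives.\<close>

lemma simplex_boundary_facet:
  fixes \<sigma> :: "'v::linorder set" and w :: "'v set \<Rightarrow> 'r::idom"
  assumes "finite \<sigma>" "x \<in> \<sigma>"
  shows "simplex_boundary w \<sigma> (\<sigma> - {x}) =
    exact_quotient (w \<sigma>) (w (\<sigma> - {x})) * (- 1) ^ card {v\<in>\<sigma>. v < x}"
proof -
  let ?xs = "sorted_list_of_set \<sigma>"
  have pos: "card \<sigma> > 0" using assms card_gt_0_iff by blast
  obtain k where k: "k < card \<sigma>" "x = ?xs ! k"
    using assms by (metis in_set_conv_nth set_sorted_list_of_set length_sorted_list_of_set)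
  have uniq: "\<sigma> - {x} = simplex_face i \<sigma> \<longleftrightarrow> i = k" if "i \<in> {0..simplex_dim \<sigma>}" for i
  proof -
    have i: "i < card \<sigma>" using that pos by (auto simp: simplex_dim_def)
    hence "?xs ! i \<in> \<sigma>" using assms(1)
      by (metis nth_mem set_sorted_list_of_set length_sorted_list_of_set)
    hence "\<sigma> - {x} = simplex_face i \<sigma> \<longleftrightarrow> ?xs ! i = x"
      using assms(2) by (auto simp: simplex_face_def)
    also have "\<dots> \<longleftrightarrow> i = k" using i k by (simp add: nth_eq_iff_index_eq)
    finally show ?thesis .
  qed
  have kr: "k \<in> {0..simplex_dim \<sigma>}" using k by (auto simp: simplex_dim_def)
  have "simplex_boundary w \<sigma> (\<sigma> - {x}) =
      (\<Sum>i = 0..simplex_dim \<sigma>. if i = k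
        then exact_quotient (w \<sigma>) (w (simplex_face i \<sigma>)) * (- 1) ^ i else 0)"
    unfolding simplex_boundary_def by (rule sum.cong) (use uniq in auto)
  also have "\<dots> = exact_quotient (w \<sigma>) (w (simplex_face k \<sigma>)) * (- 1) ^ k"
    using kr by simp
  also have "simplex_face k \<sigma> = \<sigma> - {x}" using uniq[OF kr] by simp
  finally show ?thesis using card_sorted_list_nth[OF assms(1) k(1)] k(2) by simp
qed

lemma simplex_boundary_nonzeroD:
  fixes \<sigma> :: "'v::linorder set"
  assumes "finite \<sigma>" "\<sigma> \<noteq> {}" "simplex_boundary w \<sigma> \<rho> \<noteq> 0"
  shows "\<exists>x\<in>\<sigma>. \<rho> = \<sigma> - {x}"
proof -
  obtain i where i: "i \<in> {0..simplex_dim \<sigma>}" "\<rho> = simplex_face i \<sigma>"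
    using assms(3) unfolding simplex_boundary_def
    by (auto elim!: sum.not_neutral_contains_not_neutral split: if_splits)
  hence "i < card \<sigma>" using assms card_gt_0_iff[of \<sigma>] by (auto simp: simplex_dim_def)
  hence "sorted_list_of_set \<sigma> ! i \<in> \<sigma>" using assms(1)
    by (metis nth_mem set_sorted_list_of_set length_sorted_list_of_set)
  thus ?thesis using i by (auto simp: simplex_face_def)
qed

section \<open>Chains and the boundary map\<close>

lemma chain_moduleI:
  "(\<And>\<sigma>. c \<sigma> \<noteq> 0 \<Longrightarrow> \<sigma> \<in> chain_basis K w n) \<Longrightarrow> c \<in> carrier (chain_module K w n)"
  by (simp add: chain_module_def)

lemma chain_moduleD:
  "c \<in> carrier (chain_module K w n) \<Longrightarrow> c \<sigma> \<noteq> 0 \<Longrightarrow> \<sigma> \<in> chain_basis K w n"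
  by (simp add: chain_module_def)

lemma fun_submodule_chains: "fun_submodule (carrier (chain_module K w n))"
proof -
  have "x s \<noteq> 0 \<or> y s \<noteq> 0" if "x s + y s \<noteq> 0" for x y :: "'a set \<Rightarrow> 'b" and s
    using that by auto
  thus ?thesis unfolding fun_submodule_def chain_module_def by fastforce
qed

lemma weighted_boundary_add:
  "weighted_boundary K w n (\<lambda>\<sigma>. c \<sigma> + d \<sigma>) =
    (\<lambda>\<rho>. weighted_boundary K w n c \<rho> + weighted_boundary K w n d \<rho>)"
  by (auto simp: weighted_boundary_def sum.distrib algebra_simps)

lemma weighted_boundary_smult:
  "weighted_boundary K w n (\<lambda>\<sigma>. r * c \<sigma>) = (\<lambda>\<rho>. r * weighted_boundary K w n c \<rho>)"
  by (auto simp: weighted_boundary_def sum_distrib_left algebra_simps)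

lemma fun_submodule_cycles: "fun_submodule (cycles K w n)"
proof -
  have "weighted_boundary K w n (\<lambda>_. 0) = (\<lambda>_. 0)" by (auto simp: weighted_boundary_def)
  thus ?thesis using fun_submodule_chains[of K w n]
    by (simp add: fun_submodule_def cycles_def weighted_boundary_add weighted_boundary_smult)
qed

lemma fun_submodule_boundaries: "fun_submodule (boundaries K w n)"
proof -
  let ?C = "carrier (chain_module K w (n + 1))" and ?D = "weighted_boundary K w (n + 1)"
  have C: "fun_submodule ?C" by (rule fun_submodule_chains)
  have "?D (\<lambda>_. 0) = (\<lambda>_. 0)" by (auto simp: weighted_boundary_def)
  moreover have "(\<lambda>_. 0) \<in> ?C" using C by (simp add: fun_submodule_def)
  ultimately have "(\<lambda>_. 0) \<in> ?D ` ?C" by force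
  moreover have "(\<lambda>s. x s + y s) \<in> ?D ` ?C" if xy: "x \<in> ?D ` ?C" "y \<in> ?D ` ?C" for x y
  proof -
    obtain c d where "c \<in> ?C" "d \<in> ?C" "x = ?D c" "y = ?D d" using xy by blast
    thus ?thesis using fun_submodule_add[OF C]
      by (intro image_eqI[of _ _ "\<lambda>s. c s + d s"]) (auto simp: weighted_boundary_add)
  qed
  moreover have "(\<lambda>s. r * x s) \<in> ?D ` ?C" if x: "x \<in> ?D ` ?C" for r x
  proof -
    obtain c where "c \<in> ?C" "x = ?D c" using x by blast
    thus ?thesis using fun_submodule_smult[OF C]
      by (intro image_eqI[of _ _ "\<lambda>s. r * c s"]) (auto simp: weighted_boundary_smult)
  qed
  ultimately show ?thesis unfolding fun_submodule_def boundaries_def by blast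
qed

text \<open>The two sums differ only by simplices outside \<open>L\<close>, where the chain has
  coefficient zero.\<close>

lemma weighted_boundary_subcomplex:
  assumes "simplicial_complex K" "L \<subseteq> K" "c \<in> carrier (chain_module L w n)"
  shows "weighted_boundary L w n c = weighted_boundary K w n c"
proof -
  have fin: "finite (chain_basis K w n)" and sub: "chain_basis L w n \<subseteq> chain_basis K w n"
    using assms(1,2) by (auto simp: chain_basis_def simplicial_complex_def)
  have "(\<Sum>\<sigma>\<in>chain_basis L w n. c \<sigma> * simplex_boundary w \<sigma> \<rho>) =
        (\<Sum>\<sigma>\<in>chain_basis K w n. c \<sigma> * simplex_boundary w \<sigma> \<rho>)" for \<rho>
    by (rule sum.mono_neutral_left[OF fin sub]) (use chain_moduleD[OF assms(3)] in force)
  thus ?thesis unfolding weighted_boundary_def by presburger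
qed

lemma chains_mono:
  "L \<subseteq> K \<Longrightarrow> carrier (chain_module L w n) \<subseteq> carrier (chain_module K w n)"
  by (auto simp: chain_module_def chain_basis_def)

lemma chain_basis_finite:
  assumes "weighted_simplicial_complex K w"
  shows "finite (chain_basis K w n)"
    and "\<sigma> \<in> chain_basis K w n \<Longrightarrow> finite \<sigma>" and "\<sigma> \<in> chain_basis K w n \<Longrightarrow> \<sigma> \<noteq> {}"
  using assms
  by (simp_all add: weighted_simplicial_complex_def simplicial_complex_def chain_basis_def)

text \<open>A divisor of a nonzero element is nonzero, so the simplices of nonzero weight are closed
  under passing to facets.\<close>

lemma chain_basis_facet:
  assumes "weighted_simplicial_complex K w" "\<sigma> \<in> chain_basis K w (Suc n)" "x \<in> \<sigma>"
  shows "\<sigma> - {x} \<in> chain_basis K w n" "w (\<sigma> - {x}) dvd w \<sigma>"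
proof -
  have s: "\<sigma> \<in> K" "finite \<sigma>" "card \<sigma> = Suc (Suc n)" "w \<sigma> \<noteq> 0"
    using assms simplicial_complex_finite_simplex
    by (auto simp: weighted_simplicial_complex_def chain_basis_def simplex_dim_def)
  \<comment> \<open>In positive dimension at least two vertices are present, so deleting one leaves
    a simplex.\<close>
  have c: "card (\<sigma> - {x}) = Suc n" using s assms(3) by simp
  hence ne: "\<sigma> - {x} \<noteq> {}" by force
  have mem: "\<sigma> - {x} \<in> K"
    using assms(1) ne simplicial_complex_face[OF _ s(1)]
    by (simp add: weighted_simplicial_complex_def)
  thus dvd: "w (\<sigma> - {x}) dvd w \<sigma>"
    using assms(1) s(1) unfolding weighted_simplicial_complex_def by blast
  show "\<sigma> - {x} \<in> chain_basis K w n"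
    using mem c s dvd by (auto simp: chain_basis_def simplex_dim_def)
qed

lemma weighted_boundary_chain:
  assumes "weighted_simplicial_complex K w"
  shows "weighted_boundary K w (Suc n) c \<in> carrier (chain_module K w n)"
proof (rule chain_moduleI)
  fix \<rho> assume "weighted_boundary K w (Suc n) c \<rho> \<noteq> 0"
  then obtain \<sigma> where s: "\<sigma> \<in> chain_basis K w (Suc n)" "simplex_boundary w \<sigma> \<rho> \<noteq> 0"
    unfolding weighted_boundary_def
    by (auto elim!: sum.not_neutral_contains_not_neutral split: if_splits)
  moreover have "finite \<sigma>" "\<sigma> \<noteq> {}"
    using chain_basis_finite[OF assms] s(1) by blast+
  ultimately show "\<rho> \<in> chain_basis K w n"
    using simplex_boundary_nonzeroD chain_basis_facet(1)[OF assms] by metis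
qed

text \<open>The two paths from \<sigma> to a face with two vertices fewer cancel. Multiplying by
  \<open>w \<pi>\<close> clears the exact quotients: along either path the product becomes
  \<open>w \<sigma>\<close> up to sign, and cancelling the nonzero \<open>w \<pi>\<close> returns
  the claim.\<close>

lemma simplex_boundary_composite:
  fixes w :: "'v::linorder set \<Rightarrow> 'r::idom"
  assumes K: "weighted_simplicial_complex K w" and \<sigma>: "\<sigma> \<in> chain_basis K w (Suc (Suc n))"
  shows "(\<Sum>\<rho>\<in>chain_basis K w (Suc n). simplex_boundary w \<sigma> \<rho> * simplex_boundary w \<rho> \<pi>) = 0"
    (is "sum ?g _ = 0")
proof (cases "\<exists>x\<in>\<sigma>. \<exists>y\<in>\<sigma>. x < y \<and> \<pi> = \<sigma> - {x} - {y}")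
  case False
  have "?g \<rho> = 0" if r: "\<rho> \<in> chain_basis K w (Suc n)" for \<rho>
  proof (rule ccontr)
    assume nz: "?g \<rho> \<noteq> 0"
    have fin: "finite \<sigma>" "\<sigma> \<noteq> {}" "finite \<rho>" "\<rho> \<noteq> {}"
      using chain_basis_finite[OF K] r \<sigma> by blast+
    obtain x where x: "x \<in> \<sigma>" "\<rho> = \<sigma> - {x}" using nz fin simplex_boundary_nonzeroD[of \<sigma> w \<rho>] by auto
    obtain y where y: "y \<in> \<rho>" "\<pi> = \<rho> - {y}" using nz fin simplex_boundary_nonzeroD[of \<rho> w \<pi>] by auto
    have "x < y \<or> y < x" using x y by auto
    moreover have "\<sigma> - {x} - {y} = \<sigma> - {y} - {x}" by auto
    ultimately show False using False x y by auto
  qed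
  thus ?thesis by (rule sum.neutral[rule_format])
next
  case True
  then obtain x y where xy: "x \<in> \<sigma>" "y \<in> \<sigma>" "x < y" and pi: "\<pi> = \<sigma> - {x} - {y}" by auto
  have pi': "\<pi> = \<sigma> - {y} - {x}" using pi by auto
  have fin: "finite \<sigma>" "\<sigma> \<noteq> {}" "finite (chain_basis K w (Suc n))"
    using chain_basis_finite[OF K] \<sigma> by blast+
  \<comment> \<open>Only the two facets obtained by deleting \<open>x\<close> or \<open>y\<close>
    lie between \<pi> and \<sigma>.\<close>
  have supp: "?g \<rho> = 0" if r: "\<rho> \<in> chain_basis K w (Suc n)" "\<rho> \<notin> {\<sigma> - {x}, \<sigma> - {y}}" for \<rho>
  proof (rule ccontr)
    assume nz: "?g \<rho> \<noteq> 0"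
    have fr: "finite \<rho>" "\<rho> \<noteq> {}"
      using chain_basis_finite[OF K] r(1) by blast+
    obtain z where z: "z \<in> \<sigma>" "\<rho> = \<sigma> - {z}" using nz fin simplex_boundary_nonzeroD[of \<sigma> w \<rho>] by auto
    obtain u where "\<pi> = \<rho> - {u}" using nz fr simplex_boundary_nonzeroD[of \<rho> w \<pi>] by auto
    hence "z = x \<or> z = y" using z pi by auto
    thus False using r z by auto
  qed
  have fx: "\<sigma> - {x} \<in> chain_basis K w (Suc n)" "w (\<sigma> - {x}) dvd w \<sigma>"
    and fy: "\<sigma> - {y} \<in> chain_basis K w (Suc n)" "w (\<sigma> - {y}) dvd w \<sigma>"
    using chain_basis_facet[OF K \<sigma>] xy by auto
  have px: "\<pi> \<in> chain_basis K w n" "w \<pi> dvd w (\<sigma> - {x})"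
    using chain_basis_facet[OF K fx(1), of y] xy pi by auto
  have py: "w \<pi> dvd w (\<sigma> - {y})"
    using chain_basis_facet[OF K fy(1), of x] xy pi' by auto
  have nz: "w (\<sigma> - {x}) \<noteq> 0" "w (\<sigma> - {y}) \<noteq> 0" "w \<pi> \<noteq> 0"
    using fx fy px by (auto simp: chain_basis_def)
  let ?a = "card {v\<in>\<sigma>. v < x}" and ?b = "card {v\<in>\<sigma> - {x}. v < y}"
  \<comment> \<open>As \<open>x < y\<close>, deleting \<open>y\<close> does not change the count
    below \<open>x\<close>, while deleting \<open>x\<close> lowers the count below \<open>y\<close>
    by one. This shift makes the two signs opposite.\<close>
  have "{v\<in>\<sigma> - {y}. v < x} = {v\<in>\<sigma>. v < x}" using xy by auto
  hence cx: "card {v\<in>\<sigma> - {y}. v < x} = ?a" by simp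
  have "{v\<in>\<sigma>. v < y} = insert x {v\<in>\<sigma> - {x}. v < y}" using xy by auto
  hence cy: "card {v\<in>\<sigma>. v < y} = Suc ?b" using fin by simp
  have "w \<pi> * ?g (\<sigma> - {x}) = w \<sigma> * ((- 1) ^ ?a * (- 1) ^ ?b)"
  proof -
    have "w \<pi> * ?g (\<sigma> - {x}) = (exact_quotient (w \<sigma>) (w (\<sigma> - {x})) *
        (exact_quotient (w (\<sigma> - {x})) (w \<pi>) * w \<pi>)) * ((- 1) ^ ?a * (- 1) ^ ?b)"
      using simplex_boundary_facet[of \<sigma> x w] simplex_boundary_facet[of "\<sigma> - {x}" y w] fin xy
      by (simp add: pi)
    thus ?thesis unfolding exact_quotient_mult[OF px(2) nz(3)] exact_quotient_mult[OF fx(2) nz(1)] .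
  qed
  moreover have "w \<pi> * ?g (\<sigma> - {y}) = w \<sigma> * ((- 1) ^ Suc ?b * (- 1) ^ ?a)"
  proof -
    have "w \<pi> * ?g (\<sigma> - {y}) = (exact_quotient (w \<sigma>) (w (\<sigma> - {y})) *
        (exact_quotient (w (\<sigma> - {y})) (w \<pi>) * w \<pi>)) * ((- 1) ^ Suc ?b * (- 1) ^ ?a)"
      using simplex_boundary_facet[of \<sigma> y w] simplex_boundary_facet[of "\<sigma> - {y}" x w] fin xy cx cy
      by (simp add: pi')
    thus ?thesis unfolding exact_quotient_mult[OF py nz(3)] exact_quotient_mult[OF fy(2) nz(2)] .
  qed
  ultimately have "w \<pi> * (?g (\<sigma> - {x}) + ?g (\<sigma> - {y})) = 0"
    by (simp add: distrib_left)
  hence "?g (\<sigma> - {x}) + ?g (\<sigma> - {y}) = 0" using nz by simp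
  moreover have "sum ?g (chain_basis K w (Suc n)) = sum ?g {\<sigma> - {x}, \<sigma> - {y}}"
    using fin fx fy supp by (intro sum.mono_neutral_right) auto
  moreover have "\<sigma> - {x} \<noteq> \<sigma> - {y}" using xy by auto
  ultimately show ?thesis by simp
qed

text \<open>Exchanging the two sums isolates the composite on each basis simplex; in degree zero the
  outer map vanishes by definition.\<close>

lemma weighted_boundary_boundary:
  assumes K: "weighted_simplicial_complex K w"
  shows "weighted_boundary K w n (weighted_boundary K w (Suc n) c) = (\<lambda>_. 0)"
proof (cases n)
  case 0
  thus ?thesis by (simp add: weighted_boundary_def)
next
  case (Suc m)
  have "weighted_boundary K w n (weighted_boundary K w (Suc n) c) \<pi> = 0" for \<pi>
  proof -
    let ?s = "\<lambda>\<sigma> \<rho>. simplex_boundary w \<sigma> \<rho>"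
    have "weighted_boundary K w n (weighted_boundary K w (Suc n) c) \<pi> =
        (\<Sum>\<rho>\<in>chain_basis K w n. \<Sum>\<sigma>\<in>chain_basis K w (Suc n). c \<sigma> * (?s \<sigma> \<rho> * ?s \<rho> \<pi>))"
      by (simp add: weighted_boundary_def Suc sum_distrib_right mult.assoc)
    also have "\<dots> = (\<Sum>\<sigma>\<in>chain_basis K w (Suc n). c \<sigma> * (\<Sum>\<rho>\<in>chain_basis K w n. ?s \<sigma> \<rho> * ?s \<rho> \<pi>))"
      by (subst sum.swap) (simp add: sum_distrib_left)
    also have "\<dots> = 0"
      using simplex_boundary_composite[OF K] by (simp add: Suc)
    finally show ?thesis .
  qed
  thus ?thesis by auto
qed

lemma boundaries_subset_cycles:
  "weighted_simplicial_complex K w \<Longrightarrow> boundaries K w n \<subseteq> cycles K w n"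
  by (auto simp: boundaries_def cycles_def weighted_boundary_chain weighted_boundary_boundary)

section \<open>Collapses that preserve weighted homology\<close>

text \<open>States that the inclusion of \<open>L\<close> induces an isomorphism in degree
  \<open>i\<close>: the clause on boundaries gives injectivity, the last one surjectivity.\<close>

definition homology_retract ::
    "'v::linorder set set \<Rightarrow> 'v set set \<Rightarrow> ('v set \<Rightarrow> 'r::idom) \<Rightarrow> nat \<Rightarrow> bool" where
  "homology_retract K L w i \<longleftrightarrow> cycles L w i \<subseteq> cycles K w i \<and>
     boundaries L w i = boundaries K w i \<inter> cycles L w i \<and>
     (\<forall>z\<in>cycles K w i. \<exists>z'\<in>cycles L w i. (\<lambda>s. z s - z' s) \<in> boundaries K w i)"

lemma homology_retract_refl:
  assumes "weighted_simplicial_complex K w"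
  shows "homology_retract K K w i"
proof -
  have "\<exists>z'\<in>cycles K w i. (\<lambda>s. z s - z' s) \<in> boundaries K w i" if "z \<in> cycles K w i" for z
    using that fun_submodule_boundaries[of K w i]
    by (intro bexI[of _ z]) (auto simp: fun_submodule_def)
  thus ?thesis using boundaries_subset_cycles[OF assms]
    unfolding homology_retract_def by blast
qed

lemma homology_retract_trans:
  assumes KL: "homology_retract K L w i" and LM: "homology_retract L M w i"
  shows "homology_retract K M w i"
proof -
  have "\<exists>z''\<in>cycles M w i. (\<lambda>s. z s - z'' s) \<in> boundaries K w i" if z: "z \<in> cycles K w i" for z
  proof -
    obtain z' where z': "z' \<in> cycles L w i" "(\<lambda>s. z s - z' s) \<in> boundaries K w i"
      using KL z unfolding homology_retract_def by blast
    obtain z'' where z'': "z'' \<in> cycles M w i" "(\<lambda>s. z' s - z'' s) \<in> boundaries L w i"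
      using LM z' unfolding homology_retract_def by blast
    have "(\<lambda>s. z' s - z'' s) \<in> boundaries K w i" using KL z'' unfolding homology_retract_def by blast
    from fun_submodule_add[OF fun_submodule_boundaries z'(2) this]
    show ?thesis using z'' by auto
  qed
  thus ?thesis using KL LM unfolding homology_retract_def by blast
qed

lemma homology_retract_module_isomorphic:
  assumes "homology_retract K L w i"
  shows "module_isomorphic (weighted_homology K w i) (weighted_homology L w i)"
proof -
  have "weighted_homology X w i = quotient_module (fun_module (cycles X w i)) (boundaries X w i)" for X
    by (simp add: weighted_homology_def chain_module_def fun_module_def)
  moreover have "module_isomorphic (quotient_module (fun_module (cycles K w i)) (boundaries K w i))
      (quotient_module (fun_module (cycles L w i)) (boundaries L w i))"
    using assms unfolding homology_retract_def
    by (intro quotient_module_isomorphic[OF fun_submodule_cycles fun_submodule_boundaries]) blast+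
  ultimately show ?thesis by simp
qed

text \<open>The definition of a free face leaves the codimension open. Adding one vertex of \<tau>
  to \<sigma> already gives a simplex properly above \<sigma>, which must then be \<tau>.\<close>

lemma free_face_card:
  assumes "simplicial_complex K" "free_face K \<sigma> \<tau>"
  shows "card \<tau> = Suc (card \<sigma>)"
proof -
  have s: "\<sigma> \<in> K" "\<tau> \<in> K" "\<sigma> \<subset> \<tau>" and u: "\<And>\<rho>. \<rho> \<in> K \<Longrightarrow> \<sigma> \<subset> \<rho> \<Longrightarrow> \<rho> = \<tau>"
    using assms(2) unfolding free_face_def by auto
  obtain x where x: "x \<in> \<tau>" "x \<notin> \<sigma>" using s by blast
  have "insert x \<sigma> \<in> K"
    using s x by (intro simplicial_complex_face[OF assms(1) s(2)]) auto
  hence "insert x \<sigma> = \<tau>" using u x by blast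
  thus ?thesis using x simplicial_complex_finite_simplex[OF assms(1) s(1)] by auto
qed

text \<open>A remaining simplex with \<sigma> or \<tau> as a face would lie properly above \<sigma>
  and hence be \<tau>.\<close>

lemma simplicial_complex_collapse:
  assumes "simplicial_complex K" "free_face K \<sigma> \<tau>"
  shows "simplicial_complex (K - {\<sigma>, \<tau>})"
proof -
  have closed: "\<rho> \<in> K - {\<sigma>, \<tau>}" if "\<pi> \<in> K - {\<sigma>, \<tau>}" "\<rho> \<subseteq> \<pi>" "\<rho> \<noteq> {}" for \<rho> \<pi>
  proof -
    have "\<rho> \<notin> {\<sigma>, \<tau>}"
    proof
      assume "\<rho> \<in> {\<sigma>, \<tau>}"
      hence "\<sigma> \<subset> \<pi>" using that assms(2) unfolding free_face_def by blast
      thus False using that assms(2) unfolding free_face_def by blast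
    qed
    thus ?thesis using simplicial_complex_face[OF assms(1) _ that(2,3)] that(1) by blast
  qed
  have "finite (K - {\<sigma>, \<tau>})" using assms(1) by (simp add: simplicial_complex_def)
  moreover have "finite \<pi> \<and> \<pi> \<noteq> {}" if "\<pi> \<in> K - {\<sigma>, \<tau>}" for \<pi>
    using that assms(1) unfolding simplicial_complex_def by blast
  ultimately show ?thesis using closed unfolding simplicial_complex_def by blast
qed

text \<open>The coefficient of \<open>\<sigma>\<close> in the boundary of \<open>\<tau>\<close> is a unit precisely because the weights
  agree, so adding a multiple of that boundary removes \<open>\<sigma>\<close> from a chain.\<close>

lemma collapse_homology_retract:
  fixes w :: "'v::linorder set \<Rightarrow> 'r::idom"
  assumes K: "weighted_simplicial_complex K w" and free: "free_face K \<sigma> \<tau>"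
    and weq: "w \<sigma> = w \<tau>" and wnz: "w \<tau> \<noteq> 0"
  shows "homology_retract K (K - {\<sigma>, \<tau>}) w i"
proof -
  let ?L = "K - {\<sigma>, \<tau>}" and ?C = "\<lambda>X n. carrier (chain_module X w n)"
  let ?D = "weighted_boundary K w"
  define n where "n = simplex_dim \<sigma>"
  define u where "u = simplex_boundary w \<tau> \<sigma>"
  have sc: "simplicial_complex K" using K by (simp add: weighted_simplicial_complex_def)
  have s: "\<sigma> \<in> K" "\<tau> \<in> K" "\<sigma> \<subset> \<tau>" and un: "\<And>\<rho>. \<rho> \<in> K \<Longrightarrow> \<sigma> \<subset> \<rho> \<Longrightarrow> \<rho> = \<tau>"
    using free unfolding free_face_def by auto
  have card: "card \<tau> = Suc (card \<sigma>)" by (rule free_face_card[OF sc free])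
  have dim: "simplex_dim \<tau> = Suc n"
    using simplex_dim_Suc_iff[OF sc s(1,2)] card n_def by simp
  have fin: "finite \<tau>" using simplicial_complex_finite_simplex[OF sc s(2)] .
  obtain x where x: "x \<in> \<tau>" "x \<notin> \<sigma>" using s by blast
  have \<sigma>x: "\<sigma> = \<tau> - {x}"
    using s x card fin by (intro card_subset_eq) auto
  have "u = (- 1) ^ card {v\<in>\<tau>. v < x}"
    using simplex_boundary_facet[OF fin x(1), of w] weq wnz
    by (simp add: u_def exact_quotient_self flip: \<sigma>x)
  \<comment> \<open>So \<open>u\<close> is its own inverse, and multiplication by \<open>u\<close>
    serves as division by it below.\<close>
  hence uu: "u * u = 1" by (simp flip: power_mult_distrib)
  \<comment> \<open>No simplex except \<tau> has \<sigma> as a facet, so this coefficient of the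
    boundary detects the coefficient of \<tau>.\<close>
  have Dsigma: "?D (Suc n) d \<sigma> = d \<tau> * u" if "d \<in> ?C K (Suc n)" for d
  proof -
    note fb = chain_basis_finite[OF K, where n = "Suc n"]
    have "\<tau> \<in> chain_basis K w (Suc n)" using s dim wnz by (simp add: chain_basis_def)
    moreover have "simplex_boundary w \<rho> \<sigma> = 0" if r: "\<rho> \<in> chain_basis K w (Suc n) - {\<tau>}" for \<rho>
    proof (rule ccontr)
      assume nz: "simplex_boundary w \<rho> \<sigma> \<noteq> 0"
      have r': "\<rho> \<in> K" "finite \<rho>" "\<rho> \<noteq> {}" using r fb(2,3)[of \<rho>] by (auto simp: chain_basis_def)
      obtain y where "y \<in> \<rho>" "\<sigma> = \<rho> - {y}" using simplex_boundary_nonzeroD[OF r'(2,3) nz] by blast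
      thus False using un[OF r'(1)] r by auto
    qed
    ultimately have "(\<Sum>\<rho>\<in>chain_basis K w (Suc n). d \<rho> * simplex_boundary w \<rho> \<sigma>) =
        (\<Sum>\<rho>\<in>{\<tau>}. d \<rho> * simplex_boundary w \<rho> \<sigma>)"
      using fb(1) by (intro sum.mono_neutral_right) auto
    thus ?thesis by (simp add: weighted_boundary_def u_def)
  qed
  have inL: "c \<in> ?C ?L j" if "c \<in> ?C K j" "c \<sigma> = 0" "c \<tau> = 0" for c j
    using that by (auto simp: chain_module_def chain_basis_def)
  have LK: "?C ?L j \<subseteq> ?C K j" for j by (rule chains_mono) auto
  have Lz: "c \<sigma> = 0" if "c \<in> ?C ?L j" for c j
    using chain_moduleD[OF that, of \<sigma>] by (auto simp: chain_basis_def)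
  \<comment> \<open>Serves twice: in degree \<open>i\<close> for cycles, and in degree
    \<open>Suc i\<close> for chains whose boundary lies in \<open>L\<close>. In the degree of \<tau>
    the premise forces the coefficient of \<tau> to vanish; in the degree of \<sigma> a correction
    is needed.\<close>
  have key: "\<exists>d'\<in>?C ?L j. \<exists>e\<in>?C K (Suc j). d = (\<lambda>s. d' s + ?D (Suc j) e s)"
    if d: "d \<in> ?C K j" and z: "j = Suc n \<Longrightarrow> ?D j d \<sigma> = 0" for d j
  proof (cases "j = n")
    case False
    have "d \<sigma> = 0" using chain_moduleD[OF d, of \<sigma>] False by (auto simp: chain_basis_def n_def)
    moreover have "d \<tau> = 0"
    proof (cases "j = Suc n")
      case True
      hence "d \<tau> * u = 0" using z d Dsigma by simp
      thus ?thesis using uu by (metis mult_eq_0_iff zero_neq_one)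
    qed (use chain_moduleD[OF d, of \<tau>] dim in \<open>auto simp: chain_basis_def\<close>)
    ultimately have "d \<in> ?C ?L j" using inL d by blast
    moreover have "(\<lambda>_. 0) \<in> ?C K (Suc j)" by (simp add: chain_module_def)
    moreover have "d = (\<lambda>s. d s + ?D (Suc j) (\<lambda>_. 0) s)" by (simp add: weighted_boundary_def)
    ultimately show ?thesis by blast
  next
    case True
    \<comment> \<open>The multiple of \<tau> whose boundary has coefficient
      \<open>d \<sigma> * u * u = d \<sigma>\<close> at \<sigma>.\<close>
    define e where "e = (\<lambda>\<rho>. if \<rho> = \<tau> then d \<sigma> * u else 0)"
    have e: "e \<in> ?C K (Suc j)"
      using s dim wnz True by (auto simp: e_def chain_module_def chain_basis_def split: if_splits)
    define d' where "d' = (\<lambda>s. d s - ?D (Suc j) e s)"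
    have d'K: "d' \<in> ?C K j" unfolding d'_def
      by (rule fun_submodule_diff[OF fun_submodule_chains d weighted_boundary_chain[OF K]])
    moreover have "d' \<sigma> = 0"
      using Dsigma e True uu by (simp add: d'_def e_def mult.assoc)
    moreover have "d' \<tau> = 0"
      using chain_moduleD[OF d'K, of \<tau>] dim True by (auto simp: chain_basis_def)
    ultimately have "d' \<in> ?C ?L j" using inL by blast
    moreover have "d = (\<lambda>s. d' s + ?D (Suc j) e s)" by (simp add: d'_def)
    ultimately show ?thesis using e by blast
  qed
  have DL: "weighted_boundary ?L w j c = ?D j c" if "c \<in> ?C ?L j" for c j
    by (rule weighted_boundary_subcomplex[OF sc _ that]) auto
  have cyc: "cycles ?L w i = cycles K w i \<inter> ?C ?L i"
    using DL LK by (auto simp: cycles_def)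
  have bd: "boundaries ?L w i = ?D (Suc i) ` ?C ?L (Suc i)"
    using DL by (auto simp: boundaries_def)
  have bdK: "boundaries K w i = ?D (Suc i) ` ?C K (Suc i)" by (simp add: boundaries_def)
  have L: "weighted_simplicial_complex ?L w"
    using K simplicial_complex_collapse[OF sc free] by (simp add: weighted_simplicial_complex_def)
  have "boundaries ?L w i = boundaries K w i \<inter> cycles ?L w i"
  proof (intro equalityI subsetI)
    fix b assume b: "b \<in> boundaries ?L w i"
    thus "b \<in> boundaries K w i \<inter> cycles ?L w i"
      using boundaries_subset_cycles[OF L, of i] LK[of "Suc i"] unfolding bd bdK by blast
  next
    fix b assume "b \<in> boundaries K w i \<inter> cycles ?L w i"
    then obtain d where d: "d \<in> ?C K (Suc i)" "b = ?D (Suc i) d" and bL: "b \<in> ?C ?L i"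
      unfolding bdK cyc by blast
    have "?D (Suc i) d \<sigma> = 0" using Lz bL d by auto
    then obtain d' e where "d' \<in> ?C ?L (Suc i)" "d = (\<lambda>s. d' s + ?D (Suc (Suc i)) e s)"
      using key[OF d(1)] by blast
    \<comment> \<open>The correction term is itself a boundary, so it disappears under the boundary
      map.\<close>
    moreover from this have "b = ?D (Suc i) d'"
      unfolding d(2) by (simp add: weighted_boundary_add weighted_boundary_boundary[OF K])
    ultimately show "b \<in> boundaries ?L w i" unfolding bd by blast
  qed
  moreover have "\<exists>z'\<in>cycles ?L w i. (\<lambda>s. z s - z' s) \<in> boundaries K w i" if z: "z \<in> cycles K w i" for z
  proof -
    have zD: "z \<in> ?C K i" "?D i z = (\<lambda>_. 0)" using z by (auto simp: cycles_def)
    have "?D i z \<sigma> = 0" using zD(2) by simp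
    then obtain z' e where ze: "z' \<in> ?C ?L i" "e \<in> ?C K (Suc i)"
        "z = (\<lambda>s. z' s + ?D (Suc i) e s)"
      using key[OF zD(1)] by blast
    have b: "(\<lambda>s. z s - z' s) \<in> boundaries K w i" using ze bdK by auto
    hence "(\<lambda>s. z s - z' s) \<in> cycles K w i" using boundaries_subset_cycles[OF K] by blast
    \<comment> \<open>\<open>z'\<close> is the difference of the cycle \<open>z\<close> and the
      boundary \<open>z - z'\<close>, hence a cycle.\<close>
    from fun_submodule_diff[OF fun_submodule_cycles z this]
    have "z' \<in> cycles ?L w i" using cyc ze by simp
    thus ?thesis using b by blast
  qed
  ultimately show ?thesis using cyc unfolding homology_retract_def by blast
qed

section \<open>Morse pairs\<close>

definition facet :: "'v set set \<Rightarrow> 'v set \<Rightarrow> 'v set \<Rightarrow> bool" where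
  "facet K \<alpha> \<beta> \<longleftrightarrow> \<alpha> \<in> K \<and> \<beta> \<in> K \<and> \<alpha> \<subset> \<beta> \<and> card \<beta> = Suc (card \<alpha>)"

text \<open>One relation covers both kinds of exceptions, seen from either end, so the two Morse
  conditions become uniqueness of the upper and of the lower partner.\<close>

definition morse_pair :: "'v set set \<Rightarrow> ('v set \<Rightarrow> real) \<Rightarrow> 'v set \<Rightarrow> 'v set \<Rightarrow> bool" where
  "morse_pair K f \<alpha> \<beta> \<longleftrightarrow> facet K \<alpha> \<beta> \<and> f \<beta> \<le> f \<alpha>"

lemma card_le_1_unique: "finite A \<Longrightarrow> card A \<le> 1 \<Longrightarrow> x \<in> A \<Longrightarrow> y \<in> A \<Longrightarrow> x = y"
  by (metis One_nat_def card_le_Suc0_iff_eq)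

locale discrete_morse =
  fixes K :: "'v set set" and f :: "'v set \<Rightarrow> real"
  assumes complex: "simplicial_complex K" and morse: "discrete_morse_function K f"
begin

lemma upper_exceptions_iff: "\<alpha> \<in> K \<Longrightarrow> \<beta> \<in> upper_exceptions K f \<alpha> \<longleftrightarrow> morse_pair K f \<alpha> \<beta>"
  using simplex_dim_Suc_iff[OF complex]
  by (auto simp: upper_exceptions_def morse_pair_def facet_def)

lemma lower_exceptions_iff: "\<alpha> \<in> K \<Longrightarrow> \<gamma> \<in> lower_exceptions K f \<alpha> \<longleftrightarrow> morse_pair K f \<gamma> \<alpha>"
  using simplex_dim_Suc_iff[OF complex]
  by (auto simp: lower_exceptions_def morse_pair_def facet_def)

lemma finite_K: "finite K"
  using complex unfolding simplicial_complex_def by (rule conjunct1)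

lemma morse_pair_upper_unique:
  assumes "morse_pair K f \<alpha> \<beta>" "morse_pair K f \<alpha> \<beta>'"
  shows "\<beta> = \<beta>'"
proof -
  have a: "\<alpha> \<in> K" using assms by (simp add: morse_pair_def facet_def)
  have fin: "finite (upper_exceptions K f \<alpha>)"
    using finite_K by (simp add: upper_exceptions_def)
  have card: "card (upper_exceptions K f \<alpha>) \<le> 1"
    using morse a unfolding discrete_morse_function_def by blast
  show ?thesis using assms
    by (intro card_le_1_unique[OF fin card]) (simp_all add: upper_exceptions_iff[OF a])
qed

lemma morse_pair_lower_unique:
  assumes "morse_pair K f \<alpha> \<beta>" "morse_pair K f \<alpha>' \<beta>"
  shows "\<alpha> = \<alpha>'"
proof -
  have a: "\<beta> \<in> K" using assms by (simp add: morse_pair_def facet_def)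
  have fin: "finite (lower_exceptions K f \<beta>)"
    using finite_K by (simp add: lower_exceptions_def)
  have card: "card (lower_exceptions K f \<beta>) \<le> 1"
    using morse a unfolding discrete_morse_function_def by blast
  show ?thesis using assms
    by (intro card_le_1_unique[OF fin card]) (simp_all add: lower_exceptions_iff[OF a])
qed

section \<open>Inequalities between neighbouring simplices\<close>

lemma facet_upper_less:
  "morse_pair K f \<alpha> \<beta> \<Longrightarrow> facet K \<alpha> \<beta>' \<Longrightarrow> \<beta>' \<noteq> \<beta> \<Longrightarrow> f \<alpha> < f \<beta>'"
  using morse_pair_upper_unique[of \<alpha> \<beta> \<beta>'] unfolding morse_pair_def not_le[symmetric] by blast

lemma facet_lower_less:
  "morse_pair K f \<alpha> \<beta> \<Longrightarrow> facet K \<alpha>' \<beta> \<Longrightarrow> \<alpha>' \<noteq> \<alpha> \<Longrightarrow> f \<alpha>' < f \<beta>"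
  using morse_pair_lower_unique[of \<alpha> \<beta> \<alpha>'] unfolding morse_pair_def not_le[symmetric] by blast

lemma facet_diff_singleton:
  assumes "\<beta> \<in> K" "x \<in> \<beta>" "\<beta> \<noteq> {x}"
  shows "facet K (\<beta> - {x}) \<beta>"
proof -
  have "card \<beta> = Suc (card (\<beta> - {x}))"
    using simplicial_complex_finite_simplex[OF complex assms(1)] assms(2) by (rule card.remove)
  moreover have "\<beta> - {x} \<in> K"
    by (rule simplicial_complex_face[OF complex assms(1)]) (use assms(2,3) in blast)+
  ultimately show ?thesis using assms(1,2) unfolding facet_def by blast
qed

lemma facet_insert:
  assumes "\<alpha> \<in> K" "\<beta> \<in> K" "\<alpha> \<subseteq> \<beta>" "x \<in> \<beta>" "x \<notin> \<alpha>"
  shows "facet K \<alpha> (insert x \<alpha>)"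
proof -
  have "insert x \<alpha> \<in> K"
    by (rule simplicial_complex_face[OF complex assms(2)]) (use assms(3,4) in blast)+
  moreover have "card (insert x \<alpha>) = Suc (card \<alpha>)"
    using simplicial_complex_finite_simplex[OF complex assms(1)] assms(5) by simp
  ultimately show ?thesis using assms(1,5) unfolding facet_def by blast
qed

text \<open>The diamond property: the other intermediate simplex adds to \<alpha> the vertex of
  \<gamma> that \<beta> misses.\<close>

lemma facet_other_intermediate:
  assumes "facet K \<alpha> \<beta>" "facet K \<beta> \<gamma>"
  obtains \<beta>' where "\<beta>' \<noteq> \<beta>" "facet K \<alpha> \<beta>'" "facet K \<beta>' \<gamma>"
proof -
  have a: "\<alpha> \<in> K" "\<beta> \<in> K" "\<gamma> \<in> K" "\<alpha> \<subset> \<beta>" "\<beta> \<subset> \<gamma>" "card \<beta> = Suc (card \<alpha>)" "card \<gamma> = Suc (card \<beta>)"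
    using assms by (auto simp: facet_def)
  obtain y where y: "y \<in> \<gamma>" "y \<notin> \<beta>" using a(5) by blast
  have ya: "y \<notin> \<alpha>" and sub: "\<alpha> \<subseteq> \<gamma>" using a(4,5) y by blast+
  have f: "facet K \<alpha> (insert y \<alpha>)" by (rule facet_insert[OF a(1,3) sub y(1) ya])
  hence "card \<gamma> = Suc (card (insert y \<alpha>))" "insert y \<alpha> \<in> K"
    using a(6,7) unfolding facet_def by simp_all
  moreover have "insert y \<alpha> \<subset> \<gamma>" using a(4,5) y by blast
  ultimately have "facet K (insert y \<alpha>) \<gamma>" using a(3) unfolding facet_def by simp
  moreover have "insert y \<alpha> \<noteq> \<beta>" using y by blast
  ultimately show thesis using that[OF _ f] by simp
qed

text \<open>The second side \<beta>' of the diamond would satisfy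
  \<open>f \<alpha> < f \<beta>' < f \<gamma>\<close>, against
  \<open>f \<gamma> \<le> f \<beta> \<le> f \<alpha>\<close>. With the uniqueness lemmas, this makes
  distinct pairs disjoint.\<close>

lemma morse_pair_not_chained:
  assumes "morse_pair K f \<alpha> \<beta>" "morse_pair K f \<beta> \<gamma>"
  shows False
proof -
  have le: "f \<beta> \<le> f \<alpha>" "f \<gamma> \<le> f \<beta>" and "facet K \<alpha> \<beta>" "facet K \<beta> \<gamma>"
    using assms by (simp_all add: morse_pair_def)
  from this(3,4) obtain \<beta>' where b: "\<beta>' \<noteq> \<beta>" "facet K \<alpha> \<beta>'" "facet K \<beta>' \<gamma>"
    by (rule facet_other_intermediate)
  have "f \<alpha> < f \<beta>'" using facet_upper_less[OF assms(1) b(2,1)] .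
  moreover have "f \<beta>' < f \<gamma>" using facet_lower_less[OF assms(2) b(3,1)] .
  ultimately show False using le by linarith
qed

text \<open>If \<beta> has two vertices outside \<alpha>, two facets of \<beta> still contain
  \<alpha>. At most one of them has value at least \<open>f \<beta>\<close>, so the descent
  continues in the other without raising the value.\<close>

lemma exists_facet_le:
  assumes "\<alpha> \<in> K" "\<beta> \<in> K" "\<alpha> \<subset> \<beta>"
  shows "\<exists>\<alpha>'. facet K \<alpha> \<alpha>' \<and> f \<alpha>' \<le> f \<beta>"
  using assms
proof (induction "card \<beta>" arbitrary: \<beta> rule: less_induct)
  case less
  obtain x where x: "x \<in> \<beta>" "x \<notin> \<alpha>" using less.prems by blast
  show ?case
  proof (cases "\<beta> = insert x \<alpha>")
    case True
    moreover have "facet K \<alpha> (insert x \<alpha>)"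
      using facet_insert[OF less.prems(1,2) _ x] less.prems(3) by blast
    ultimately show ?thesis by blast
  next
    case False
    then obtain y where y: "y \<in> \<beta>" "y \<notin> \<alpha>" "y \<noteq> x" using less.prems x by blast
    have fx: "facet K (\<beta> - {x}) \<beta>" and fy: "facet K (\<beta> - {y}) \<beta>"
      using facet_diff_singleton[OF less.prems(2)] x(1) y(1,3) by blast+
    have "\<beta> - {x} \<noteq> \<beta> - {y}" using x y by blast
    hence "\<not> (morse_pair K f (\<beta> - {x}) \<beta> \<and> morse_pair K f (\<beta> - {y}) \<beta>)"
      using morse_pair_lower_unique by blast
    then obtain z where z: "z \<in> {x, y}" "f (\<beta> - {z}) < f \<beta>" "facet K (\<beta> - {z}) \<beta>"
      using fx fy unfolding morse_pair_def not_le[symmetric] by blast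
    have "\<alpha> \<subset> \<beta> - {z}" using z(1) x y less.prems(3) by blast
    moreover have "\<beta> - {z} \<in> K" "card (\<beta> - {z}) < card \<beta>"
      using z(3) unfolding facet_def by linarith+
    ultimately obtain \<alpha>' where "facet K \<alpha> \<alpha>'" "f \<alpha>' \<le> f (\<beta> - {z})"
      using less.hyps less.prems(1) by blast
    thus ?thesis using z(2) by (meson less_imp_le order.trans)
  qed
qed

text \<open>A second coface \<rho> of \<sigma> would have \<open>f \<rho> > f \<tau>\<close> and be
  matched, so by maximality it could not be an upper partner. If its upper partner is \<pi>, the
  diamond from \<sigma> to \<pi> has another side \<rho>' with
  \<open>f \<tau> \<le> f \<rho>' < f \<pi> \<le> f \<tau>\<close>.\<close>

lemma maximal_pair_free:
  assumes L: "simplicial_complex L" "L \<subseteq> K" and A: "simplicial_complex A"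
    and matched: "\<And>\<alpha>. \<alpha> \<in> L - A \<Longrightarrow> \<exists>\<beta>\<in>L - A. morse_pair K f \<alpha> \<beta> \<or> morse_pair K f \<beta> \<alpha>"
    and pair: "\<sigma> \<in> L - A" "\<tau> \<in> L - A" "morse_pair K f \<sigma> \<tau>"
    and max: "\<And>\<alpha> \<beta>. \<alpha> \<in> L - A \<Longrightarrow> \<beta> \<in> L - A \<Longrightarrow> morse_pair K f \<alpha> \<beta> \<Longrightarrow> f \<beta> \<le> f \<tau>"
  shows "free_face L \<sigma> \<tau>"
proof -
  have facet: "facet K \<sigma> \<tau>" and le: "f \<tau> \<le> f \<sigma>" using pair by (auto simp: morse_pair_def)
  have \<sigma>ne: "\<sigma> \<noteq> {}" using pair(1) L(1) unfolding simplicial_complex_def by blast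
  have unique: "\<rho> = \<tau>" if r: "\<rho> \<in> L" "facet K \<sigma> \<rho>" for \<rho>
  proof (rule ccontr)
    assume ne: "\<rho> \<noteq> \<tau>"
    have less: "f \<tau> < f \<rho>" using facet_upper_less[OF pair(3) r(2) ne] le by simp
    \<comment> \<open>Otherwise \<sigma>, being a face of \<rho>, would belong to
      \<open>A\<close>.\<close>
    have "\<rho> \<notin> A" using simplicial_complex_face[OF A, of \<rho> \<sigma>] pair \<sigma>ne r by (auto simp: facet_def)
    then obtain \<pi> where p: "\<pi> \<in> L - A" "morse_pair K f \<rho> \<pi> \<or> morse_pair K f \<pi> \<rho>"
      using matched r by blast
    show False
    proof (cases "morse_pair K f \<pi> \<rho>")
      case True
      thus False using max[of \<pi> \<rho>] p r \<open>\<rho> \<notin> A\<close> less by force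
    next
      case False
      hence rp: "morse_pair K f \<rho> \<pi>" using p by blast
      hence "facet K \<rho> \<pi>" unfolding morse_pair_def by (rule conjunct1)
      with r(2) obtain \<rho>' where r': "\<rho>' \<noteq> \<rho>" "facet K \<sigma> \<rho>'" "facet K \<rho>' \<pi>"
        by (rule facet_other_intermediate)
      have "f \<rho>' < f \<pi>" using facet_lower_less[OF rp r'(3,1)] .
      moreover have "f \<pi> \<le> f \<tau>" using max[of \<rho> \<pi>] p r rp \<open>\<rho> \<notin> A\<close> by blast
      moreover have "f \<tau> \<le> f \<rho>'"
        using facet_upper_less[OF pair(3) r'(2)] le by (cases "\<rho>' = \<tau>") auto
      ultimately show False by linarith
    qed
  qed
  have "\<rho> = \<tau>" if r: "\<rho> \<in> L" "\<sigma> \<subset> \<rho>" for \<rho>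
  proof -
    \<comment> \<open>Cofaces of higher dimension reduce to facets: every vertex outside \<sigma>
      yields the same \<tau>, so there is only one such vertex.\<close>
    have ins: "insert x \<sigma> = \<tau>" if "x \<in> \<rho> - \<sigma>" for x
    proof (rule unique)
      show "insert x \<sigma> \<in> L" using simplicial_complex_face[OF L(1) r(1)] r that by auto
      show "facet K \<sigma> (insert x \<sigma>)" using facet_insert[of \<sigma> \<rho> x] r that pair L by blast
    qed
    obtain x where x: "x \<in> \<rho> - \<sigma>" using r by blast
    have "\<rho> - \<sigma> = {x}" using ins x by blast
    thus ?thesis using ins[OF x] r by blast
  qed
  thus ?thesis using pair facet unfolding free_face_def facet_def by blast
qed

end

text \<open>Pairs refer to the fixed ambient \<open>K\<close>, not to the shrinking
  \<open>L\<close>, so the matching and its uniqueness properties persist through the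
  induction.\<close>

lemma matched_collapse:
  fixes K :: "'v::linorder set set" and w :: "'v set \<Rightarrow> 'r::idom"
  assumes M: "discrete_morse K f"
    and L: "weighted_simplicial_complex L w" "L \<subseteq> K" and A: "simplicial_complex A" "A \<subseteq> L"
    and matched: "\<And>\<alpha>. \<alpha> \<in> L - A \<Longrightarrow> \<exists>\<beta>\<in>L - A. morse_pair K f \<alpha> \<beta> \<or> morse_pair K f \<beta> \<alpha>"
    and weights: "\<And>\<alpha> \<beta>. \<alpha> \<in> L - A \<Longrightarrow> \<beta> \<in> L - A \<Longrightarrow> morse_pair K f \<alpha> \<beta> \<Longrightarrow> w \<alpha> = w \<beta> \<and> w \<beta> \<noteq> 0"
  shows "collapses_onto L A \<and> (\<forall>i. homology_retract L A w i)"
  using L A(2) matched weights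
proof (induction "card (L - A)" arbitrary: L rule: less_induct)
  case less
  interpret discrete_morse K f by (rule M)
  note matched = less.prems(4)
  have sL: "simplicial_complex L" using less.prems(1) by (simp add: weighted_simplicial_complex_def)
  have finL: "finite (L - A)" using finite_subset[OF less.prems(2) finite_K] by simp
  show ?case
  proof (cases "L - A = {}")
    case True
    hence "L = A" using less.prems(3) by blast
    thus ?thesis using homology_retract_refl less.prems(1) by (auto simp: collapses_onto_def)
  next
    case False
    \<comment> \<open>The upper members of the remaining pairs, among which the largest value is
      sought.\<close>
    let ?T = "{\<tau> \<in> L - A. \<exists>\<sigma>\<in>L - A. morse_pair K f \<sigma> \<tau>}"
    obtain \<alpha> where "\<alpha> \<in> L - A" using False by blast
    moreover from matched[OF this]
    obtain \<beta> where "\<beta> \<in> L - A" "morse_pair K f \<alpha> \<beta> \<or> morse_pair K f \<beta> \<alpha>" by blast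
    ultimately have "\<alpha> \<in> ?T \<or> \<beta> \<in> ?T" by blast
    hence "?T \<noteq> {}" by blast
    moreover have finT: "finite ?T" by (rule finite_subset[OF _ finL]) blast
    ultimately have "Max (f ` ?T) \<in> f ` ?T" by (intro Max_in) simp_all
    then obtain \<tau> where t: "Max (f ` ?T) = f \<tau>" "\<tau> \<in> ?T" by (rule imageE)
    obtain \<sigma> where s: "\<sigma> \<in> L - A" "morse_pair K f \<sigma> \<tau>" using t by blast
    have tm: "\<tau> \<in> L - A" using t by blast
    have "f \<beta> \<le> f \<tau>" if "\<alpha> \<in> L - A" "\<beta> \<in> L - A" "morse_pair K f \<alpha> \<beta>" for \<alpha> \<beta>
    proof -
      have "\<beta> \<in> ?T" using that by blast
      thus ?thesis unfolding t(1)[symmetric] using finT by (intro Max_ge finite_imageI imageI)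
    qed
    with sL less.prems(2) A(1) matched s(1) tm s(2)
    have free: "free_face L \<sigma> \<tau>" by (rule maximal_pair_free)
    let ?L = "L - {\<sigma>, \<tau>}"
    have w: "w \<sigma> = w \<tau>" "w \<tau> \<noteq> 0" using less.prems(5)[OF s(1) tm s(2)] by auto
    have "?L - A \<subset> L - A" using s(1) by blast
    hence "card (?L - A) < card (L - A)" by (rule psubset_card_mono[OF finL])
    moreover have "weighted_simplicial_complex ?L w"
      using less.prems(1) simplicial_complex_collapse[OF sL free]
      unfolding weighted_simplicial_complex_def by blast
    moreover have "?L \<subseteq> K" "A \<subseteq> ?L" using less.prems(2,3) s(1) tm by blast+
    \<comment> \<open>Partners survive the removal: uniqueness excludes sharing an end with the
      removed pair, and the absence of chains excludes the two other ways of meeting it.\<close>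
    moreover have "\<exists>\<beta>\<in>?L - A. morse_pair K f \<alpha> \<beta> \<or> morse_pair K f \<beta> \<alpha>" if a: "\<alpha> \<in> ?L - A" for \<alpha>
    proof -
      have "\<alpha> \<in> L - A" and ne: "\<alpha> \<noteq> \<sigma>" "\<alpha> \<noteq> \<tau>" using a by blast+
      from matched[OF this(1)]
      obtain \<beta> where b: "\<beta> \<in> L - A" "morse_pair K f \<alpha> \<beta> \<or> morse_pair K f \<beta> \<alpha>" by blast
      have "\<not> morse_pair K f \<sigma> \<alpha>" "\<not> morse_pair K f \<alpha> \<tau>"
        using ne morse_pair_upper_unique[OF s(2), of \<alpha>] morse_pair_lower_unique[OF s(2), of \<alpha>] by blast+
      moreover have "\<not> morse_pair K f \<alpha> \<sigma>" "\<not> morse_pair K f \<tau> \<alpha>"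
        using morse_pair_not_chained[OF _ s(2)] morse_pair_not_chained[OF s(2)] by blast+
      ultimately have "\<beta> \<noteq> \<sigma>" "\<beta> \<noteq> \<tau>" using b(2) by blast+
      thus ?thesis using b by blast
    qed
    moreover have "w \<alpha> = w \<beta> \<and> w \<beta> \<noteq> 0"
      if "\<alpha> \<in> ?L - A" "\<beta> \<in> ?L - A" "morse_pair K f \<alpha> \<beta>" for \<alpha> \<beta>
      using less.prems(5)[of \<alpha> \<beta>] that by blast
    ultimately have IH: "collapses_onto ?L A \<and> (\<forall>i. homology_retract ?L A w i)"
      by (rule less.hyps)
    have "elementary_collapse L ?L" using free unfolding elementary_collapse_def by blast
    moreover have "elementary_collapse\<^sup>*\<^sup>* ?L A" using IH unfolding collapses_onto_def by (rule conjunct1)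
    ultimately have "collapses_onto L A"
      unfolding collapses_onto_def by (rule converse_rtranclp_into_rtranclp)
    moreover have "homology_retract L A w i" for i
      using homology_retract_trans[OF collapse_homology_retract[OF less.prems(1) free w]] IH by blast
    ultimately show ?thesis by blast
  qed
qed

section \<open>Level subcomplexes\<close>

lemma simplicial_complex_level:
  assumes K: "simplicial_complex K"
  shows "simplicial_complex (level_subcomplex K f c)"
proof -
  have face: "\<tau> \<in> level_subcomplex K f c"
    if \<sigma>: "\<sigma> \<in> level_subcomplex K f c" and \<tau>: "\<tau> \<noteq> {} \<and> \<tau> \<subseteq> \<sigma>" for \<sigma> \<tau>
  proof -
    obtain \<alpha> where "\<sigma> \<in> K" "\<alpha> \<in> K" "\<sigma> \<subseteq> \<alpha>" "f \<alpha> \<le> c"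
      using \<sigma> unfolding level_subcomplex_def by blast
    moreover from this(1) have "\<tau> \<in> K" using simplicial_complex_face[OF K, of \<sigma> \<tau>] \<tau> by simp
    moreover have "\<tau> \<subseteq> \<sigma>" using \<tau> by simp
    ultimately show ?thesis unfolding level_subcomplex_def by blast
  qed
  have sub: "level_subcomplex K f c \<subseteq> K" unfolding level_subcomplex_def by blast
  have fin: "finite (level_subcomplex K f c)"
    by (rule finite_subset[OF sub]) (use K in \<open>simp add: simplicial_complex_def\<close>)
  have simplex: "finite \<sigma>" "\<sigma> \<noteq> {}" if "\<sigma> \<in> level_subcomplex K f c" for \<sigma>
    using simplex_card_pos[OF K subsetD[OF sub that]] by (simp_all add: card_gt_0_iff)
  show ?thesis
    unfolding simplicial_complex_def
    by (intro conjI ballI allI impI) (rule fin | erule simplex | erule (1) face)+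
qed

section \<open>The matching on the difference of two levels\<close>

context discrete_morse
begin

text \<open>Such a simplex enters the level only below some coface of value at most
  \<open>c\<close>, perhaps of much higher dimension; \<open>exists_facet_le\<close> replaces it by
  one of the next dimension.\<close>

lemma level_pair:
  assumes a: "\<alpha> \<in> level_subcomplex K f c" "f \<alpha> > c"
  obtains \<beta> where "morse_pair K f \<alpha> \<beta>" "f \<beta> \<le> c"
proof -
  obtain \<delta> where "\<alpha> \<in> K" "\<delta> \<in> K" "\<alpha> \<subset> \<delta>" "f \<delta> \<le> c"
    using a unfolding level_subcomplex_def by force
  then obtain \<beta> where "facet K \<alpha> \<beta>" "f \<beta> \<le> f \<delta>" using exists_facet_le[of \<alpha> \<delta>] by blast
  with \<open>f \<delta> \<le> c\<close> show thesis using that[of \<beta>] a(2) by (simp add: morse_pair_def)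
qed

text \<open>A value at most \<open>a\<close> would pull \<alpha> into the lower level. If
  \<open>f \<alpha>\<close> exceeds \<open>b\<close>, some upper partner has value at most
  \<open>b\<close>, and uniqueness identifies it with \<beta>. Thus the weight hypothesis applies to
  \<beta> even when \<open>f \<alpha>\<close> lies outside the interval.\<close>

lemma level_difference_pair_upper:
  assumes "\<alpha> \<in> level_subcomplex K f b - level_subcomplex K f a" "morse_pair K f \<alpha> \<beta>"
  shows "f \<beta> \<in> {a<..b}"
proof -
  have ab: "\<alpha> \<in> K" "\<beta> \<in> K" "\<alpha> \<subset> \<beta>" and le: "f \<beta> \<le> f \<alpha>"
    using assms(2) by (simp_all add: morse_pair_def facet_def)
  have "\<not> f \<beta> \<le> a" using assms(1) ab unfolding level_subcomplex_def by blast
  moreover have "f \<beta> \<le> b"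
  proof (cases "f \<alpha> \<le> b")
    case False
    hence "b < f \<alpha>" by simp
    then obtain \<beta>' where "morse_pair K f \<alpha> \<beta>'" "f \<beta>' \<le> b"
      by (rule level_pair[OF DiffD1[OF assms(1)]])
    moreover from this(1) have "\<beta> = \<beta>'" by (rule morse_pair_upper_unique[OF assms(2)])
    ultimately show ?thesis by simp
  qed (use le in linarith)
  ultimately show ?thesis by simp
qed

lemma level_difference_upper_mem:
  assumes "\<alpha> \<in> level_subcomplex K f b - level_subcomplex K f a" "morse_pair K f \<alpha> \<beta>"
  shows "\<beta> \<in> level_subcomplex K f b - level_subcomplex K f a"
proof -
  have "\<alpha> \<subset> \<beta>" "\<beta> \<in> K" using assms(2) by (simp_all add: morse_pair_def facet_def)
  moreover have "f \<beta> \<le> b" using level_difference_pair_upper[OF assms] by simp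
  ultimately show ?thesis
    using assms(1) unfolding level_subcomplex_def by blast
qed

text \<open>If \<gamma> were in the lower level, then \<open>f \<gamma> > a\<close> would give it an
  upper partner of value at most \<open>a\<close>; by uniqueness this is \<alpha>, whose value
  exceeds \<open>a\<close>.\<close>

lemma level_difference_lower_mem:
  assumes "morse_pair K f \<gamma> \<alpha>" "f \<alpha> \<in> {a<..b}"
  shows "\<gamma> \<in> level_subcomplex K f b - level_subcomplex K f a"
proof
  have g: "\<gamma> \<in> K" "\<alpha> \<in> K" "\<gamma> \<subset> \<alpha>" and le: "f \<alpha> \<le> f \<gamma>" "a < f \<alpha>" "f \<alpha> \<le> b"
    using assms by (simp_all add: morse_pair_def facet_def)
  show "\<gamma> \<in> level_subcomplex K f b" using g le(3) unfolding level_subcomplex_def by blast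
  show "\<gamma> \<notin> level_subcomplex K f a"
  proof
    assume "\<gamma> \<in> level_subcomplex K f a"
    moreover have "a < f \<gamma>" using le by linarith
    ultimately obtain \<beta> where "morse_pair K f \<gamma> \<beta>" "f \<beta> \<le> a" by (rule level_pair)
    moreover from this(1) have "\<alpha> = \<beta>" by (rule morse_pair_upper_unique[OF assms(1)])
    ultimately show False using le(2) by simp
  qed
qed

lemma level_difference_matched:
  assumes noncrit: "\<And>\<alpha>. \<alpha> \<in> K \<Longrightarrow> f \<alpha> \<in> {a<..b} \<Longrightarrow> \<not> critical K f \<alpha>"
    and a: "\<alpha> \<in> level_subcomplex K f b - level_subcomplex K f a" (is "_ \<in> ?D")
  shows "\<exists>\<beta>\<in>?D. morse_pair K f \<alpha> \<beta> \<or> morse_pair K f \<beta> \<alpha>"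
proof -
  have aK: "\<alpha> \<in> K" using a unfolding level_subcomplex_def by blast
  have "\<not> f \<alpha> \<le> a" using a aK unfolding level_subcomplex_def by blast
  show ?thesis
  proof (cases "f \<alpha> \<le> b")
    case True
    with \<open>\<not> f \<alpha> \<le> a\<close> have r: "f \<alpha> \<in> {a<..b}" by simp
    hence "\<not> critical K f \<alpha>" by (rule noncrit[OF aK])
    then obtain \<beta> where "morse_pair K f \<alpha> \<beta> \<or> morse_pair K f \<beta> \<alpha>"
      using upper_exceptions_iff[OF aK] lower_exceptions_iff[OF aK]
      unfolding critical_def by blast
    thus ?thesis
    proof
      assume "morse_pair K f \<alpha> \<beta>"
      thus ?thesis using level_difference_upper_mem[OF a] by blast
    next
      assume "morse_pair K f \<beta> \<alpha>"
      thus ?thesis using level_difference_lower_mem[OF _ r] by blast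
    qed
  next
    case False
    hence "b < f \<alpha>" by simp
    then obtain \<beta> where "morse_pair K f \<alpha> \<beta>" by (rule level_pair[OF DiffD1[OF a]])
    thus ?thesis using level_difference_upper_mem[OF a] by blast
  qed
qed

end

theorem theorem4p11:
  fixes K :: "'v::linorder set set"
    and w :: "'v set \<Rightarrow> 'r::idom"
    and f :: "'v set \<Rightarrow> real"
    and a b :: real
  assumes "weighted_simplicial_complex K w"
    and "discrete_morse_function K f"
    and "a < b"
    and "\<And>\<alpha>. \<alpha> \<in> K \<Longrightarrow> f \<alpha> \<in> {a<..b} \<Longrightarrow> \<not> critical K f \<alpha> \<and> w_simple K w f \<alpha>"
  shows "collapses_onto (level_subcomplex K f b) (level_subcomplex K f a) \<and>
    (\<forall>i. module_isomorphic (weighted_homology (level_subcomplex K f b) w i)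
                           (weighted_homology (level_subcomplex K f a) w i))"
proof -
  let ?B = "level_subcomplex K f b" and ?A = "level_subcomplex K f a"
  have sc: "simplicial_complex K" using assms(1) by (simp add: weighted_simplicial_complex_def)
  interpret discrete_morse K f using sc assms(2) by unfold_locales
  have BK: "?B \<subseteq> K" unfolding level_subcomplex_def by blast
  have "f \<alpha> \<le> b" if "f \<alpha> \<le> a" for \<alpha> using that assms(3) by linarith
  hence AB: "?A \<subseteq> ?B" unfolding level_subcomplex_def by blast
  have wB: "weighted_simplicial_complex ?B w"
    using assms(1) simplicial_complex_level[OF sc] BK
    unfolding weighted_simplicial_complex_def by blast
  have "w \<alpha> = w \<beta> \<and> w \<beta> \<noteq> 0" if "\<alpha> \<in> ?B - ?A" "\<beta> \<in> ?B - ?A" and p: "morse_pair K f \<alpha> \<beta>" for \<alpha> \<beta>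
  proof -
    have k: "\<alpha> \<in> K" "\<beta> \<in> K" using p by (simp_all add: morse_pair_def facet_def)
    \<comment> \<open>The condition is applied to the upper member \<beta>: it gives a nonzero
      weight and, since \<alpha> is a lower exception of \<beta>, equality of the two
      weights.\<close>
    have "w_simple K w f \<beta>"
      using level_difference_pair_upper[OF that(1) p] assms(4)[OF k(2)] by blast
    moreover have "\<alpha> \<in> lower_exceptions K f \<beta>" using lower_exceptions_iff[OF k(2)] p by blast
    ultimately show ?thesis unfolding w_simple_def lower_exceptions_def by blast
  qed
  hence "collapses_onto ?B ?A \<and> (\<forall>i. homology_retract ?B ?A w i)"
    using level_difference_matched[of a b] assms(4)
    by (intro matched_collapse[OF discrete_morse_axioms wB BK simplicial_complex_level[OF sc] AB]) blast+
  thus ?thesis using homology_retract_module_isomorphic by blast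
qed

end
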